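(* Let $L$ be a full-dimensional rational lattice-free polytope in $\mathbb{R}^m$ having the 2-hyperplane property, and let $M_0<M$ be finite numbers. For any polyhedron $Q\subseteq R(L,M,M_0)$ in $\mathbb{R}^m\times\mathbb{R}$, there exists a finite number $q$ such that the height of the rank-$q$ split closure of $Q$ is at most $M_0$.
   Context: Lattice-free: no integer point in the interior. A split is $(\pi,\pi_0)$, $\pi\in\mathbb{Z}^m$, $\pi_0\in\mathbb{Z}$, acting on the $x$-coordinates of $(x,z)\in\mathbb{R}^m\times\mathbb{R}$, with boundary hyperplanes $\{\pi x=\pi_0\}$, $\{\pi x=\pi_0+1\}$. For a polyhedron $K$, $K(\pi,\pi_0)=\mathrm{conv}((K\cap\{\pi x\le\pi_0\})\cup(K\cap\{\pi x\ge\pi_0+1\}))$; the split closure of $K$ is the intersection of all $K(\pi,\pi_0)$; rank-0 split closure is $K$ and rank-$t$ split closure is the split closure of the rank-$(t-1)$ one. Height of $\bar x\in\mathbb{R}^m$ with respect to $K$: $\max\{\bar z:(\bar x,\bar z)\in K\}$ ($+\infty$ if unbounded, $-\infty$ if empty); height of $K$: supremum over $\bar x$. $R(L,M,M_0)$ is the set of $(\bar x,\bar z)$ with $\bar z\le M$ if $\bar x\in\mathrm{int}(L)$ and $\bar z\le M_0-\frac{d(\bar x,L)}{\mathrm{diam}(L)}(M-M_0)$ otherwise ($d$ Euclidean distance, $\mathrm{diam}$ the diameter of $L$). A set of points is 2-partitionable if it has at most one element or can be partitioned into two nonempty sets lying respectively on the two boundary hyperplanes of some split. $L_I$ is the convex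 hull of integer points in $L$; $L$ has the 2-hyperplane property if every face of $L_I$ not contained in a facet of $L$ has a 2-partitionable set of integer points. *)

theory Defs
  imports "HOL-Analysis.Analysis"
begin

definition int_point :: "real^'n \<Rightarrow> bool" where
  "int_point x \<longleftrightarrow> (\<forall>i. x $ i \<in> \<int>)"

definition rat_point :: "real^'n \<Rightarrow> bool" where
  "rat_point x \<longleftrightarrow> (\<forall>i. x $ i \<in> \<rat>)"

definition rational_polytope :: "(real^'n) set \<Rightarrow> bool" where
  "rational_polytope L \<longleftrightarrow> (\<exists>V. finite V \<and> (\<forall>v\<in>V. rat_point v) \<and> L = convex hull V)"

definition full_dimensional :: "(real^'n) set \<Rightarrow> bool" where
  "full_dimensional L \<longleftrightarrow> interior L \<noteq> {}"

definition lattice_free :: "(real^'n) set \<Rightarrow> bool" where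
  "lattice_free L \<longleftrightarrow> (\<forall>x\<in>interior L. \<not> int_point x)"

definition is_split :: "real^'n \<Rightarrow> real \<Rightarrow> bool" where
  "is_split \<pi> \<pi>0 \<longleftrightarrow> int_point \<pi> \<and> \<pi> \<noteq> 0 \<and> \<pi>0 \<in> \<int>"

definition split_hull :: "((real^'n) \<times> real) set \<Rightarrow> real^'n \<Rightarrow> real \<Rightarrow> ((real^'n) \<times> real) set" where
  "split_hull K \<pi> \<pi>0 =
     convex hull ((K \<inter> {p. \<pi> \<bullet> fst p \<le> \<pi>0}) \<union> (K \<inter> {p. \<pi> \<bullet> fst p \<ge> \<pi>0 + 1}))"

definition split_closure :: "((real^'n) \<times> real) set \<Rightarrow> ((real^'n) \<times> real) set" where
  "split_closure K = (\<Inter>{split_hull K \<pi> \<pi>0 | \<pi> \<pi>0. is_split \<pi> \<pi>0})"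

definition split_closure_rank :: "nat \<Rightarrow> ((real^'n) \<times> real) set \<Rightarrow> ((real^'n) \<times> real) set" where
  "split_closure_rank t K = (split_closure ^^ t) K"

definition height_at :: "((real^'n) \<times> real) set \<Rightarrow> real^'n \<Rightarrow> ereal" where
  "height_at K x = Sup {ereal z | z. (x, z) \<in> K}"

definition height :: "((real^'n) \<times> real) set \<Rightarrow> ereal" where
  "height K = (SUP x. height_at K x)"

definition R_region :: "(real^'n) set \<Rightarrow> real \<Rightarrow> real \<Rightarrow> ((real^'n) \<times> real) set" where
  "R_region L M M0 = {(x, z). (x \<in> interior L \<longrightarrow> z \<le> M) \<and>
       (x \<notin> interior L \<longrightarrow> z \<le> M0 - infdist x L / diameter L * (M - M0))}"

definition two_partitionable :: "(real^'n) set \<Rightarrow> bool" where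
  "two_partitionable S \<longleftrightarrow> (\<exists>a. S \<subseteq> {a}) \<or>
     (\<exists>\<pi> \<pi>0 S1 S2. is_split \<pi> \<pi>0 \<and> S1 \<noteq> {} \<and> S2 \<noteq> {} \<and> S1 \<union> S2 = S \<and> S1 \<inter> S2 = {} \<and>
        (\<forall>x\<in>S1. \<pi> \<bullet> x = \<pi>0) \<and> (\<forall>x\<in>S2. \<pi> \<bullet> x = \<pi>0 + 1))"

definition integer_hull :: "(real^'n) set \<Rightarrow> (real^'n) set" where
  "integer_hull L = convex hull {x \<in> L. int_point x}"

definition two_hyperplane_property :: "(real^'n) set \<Rightarrow> bool" where
  "two_hyperplane_property L \<longleftrightarrow>
     (\<forall>F. F face_of integer_hull L \<and> \<not> (\<exists>G. G facet_of L \<and> F \<subseteq> G)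
          \<longrightarrow> two_partitionable {x \<in> F. int_point x})"

end

theory Submission
  imports Defs
begin

text \<open>
  Write \<open>V\<close> for the integer points of \<open>L\<close>, \<open>P\<close> for their convex hull, and \<open>D\<close> for a distance-like
  function to \<open>P\<close>. In the limit of the (closed) iterated split closures the set of highest points is
  fixed by all unit splits, hence so are its faces, and each of them contains an integer point.
  Since integer points have height at most \<open>M0\<close>, compactness gives, for every \<open>\<delta> > 0\<close>, the bound
  \<open>z \<le> M0 + c * (\<delta> - D x)\<close> after finitely many rounds, for all small \<open>c > 0\<close>.

  To reach \<open>M0\<close> exactly one uses that an affine bound valid outside the interior of a split becomes
  valid everywhere one round later. For a facet \<open>a \<bullet> x \<le> b\<close> of \<open>L\<close> (integral by rationality of \<open>L\<close>)
  this yields \<open>z \<le> M0 + c * (\<rho> * (b - a \<bullet> x) - D x)\<close>. The same form of bound, with a face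
  \<open>g \<bullet> x \<le> \<gamma>\<close> of \<open>P\<close> in place of the facet, is propagated from smaller to larger faces of \<open>P\<close>: faces
  inside a facet of \<open>L\<close> inherit it from there, and all others are split into two smaller faces by
  the 2-hyperplane property. For the face \<open>P\<close> itself the bound reads \<open>z \<le> M0 - c * D x \<le> M0\<close>.
\<close>

subsection \<open>Integral generators of valid inequalities\<close>

text \<open>Integrality is stated for any Euclidean space so that a coefficient pair
  \<open>(a, b)\<close> of an inequality can be handled as a single vector during
  elimination.\<close>

definition int_vec :: "'a::euclidean_space \<Rightarrow> bool" where
  "int_vec y \<longleftrightarrow> (\<forall>b\<in>Basis. y \<bullet> b \<in> \<int>)"

lemma int_vec_inner: "int_vec x \<Longrightarrow> int_vec y \<Longrightarrow> x \<bullet> y \<in> \<int>"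
  unfolding int_vec_def euclidean_inner[of x y] by (intro Ints_sum Ints_mult) auto

lemma int_vec_Pair:
  fixes a :: "real^'n" and b :: real
  shows "int_vec (a, b) \<longleftrightarrow> int_point a \<and> b \<in> \<int>"
  by (auto simp: int_vec_def Basis_prod_def int_point_def Basis_vec_def inner_axis)

lemma convex_cone_linear_vimage:
  "linear f \<Longrightarrow> convex_cone C \<Longrightarrow> convex_cone {x. f x \<in> C}"
  by (auto simp: convex_cone_iff linear_0 linear_add linear_cmul)

text \<open>The expression is linear in \<open>n\<close> for fixed \<open>p\<close> and vice versa,
  so hull induction, first on \<open>n\<close> and then on \<open>p\<close>, reduces it to pairs of
  generators, where it is itself a listed generator.\<close>

lemma cone_elimination:
  fixes a :: "'a::real_inner"
  assumes p: "p \<in> convex_cone hull {w\<in>W. 0 \<le> a \<bullet> w}"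
    and n: "n \<in> convex_cone hull {w\<in>W. a \<bullet> w < 0}"
  shows "(a \<bullet> p) *\<^sub>R n - (a \<bullet> n) *\<^sub>R p \<in> convex_cone hull
    ({w\<in>W. 0 \<le> a \<bullet> w} \<union> (\<lambda>(w,w'). (a \<bullet> w) *\<^sub>R w' - (a \<bullet> w') *\<^sub>R w) `
      ({w\<in>W. 0 \<le> a \<bullet> w} \<times> {w\<in>W. a \<bullet> w < 0}))" (is "_ \<in> ?C")
proof -
  have C: "convex_cone ?C" by (rule convex_cone_convex_cone_hull)
  have 1: "(a \<bullet> w) *\<^sub>R n - (a \<bullet> n) *\<^sub>R w \<in> ?C" if w: "w \<in> W" "0 \<le> a \<bullet> w" for w
    using n
  proof (rule hull_induct)
    fix w' assume "w' \<in> {w \<in> W. a \<bullet> w < 0}"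
    with w show "(a \<bullet> w) *\<^sub>R w' - (a \<bullet> w') *\<^sub>R w \<in> ?C"
      by (intro hull_inc) auto
  next
    show "convex_cone {n. (a \<bullet> w) *\<^sub>R n - (a \<bullet> n) *\<^sub>R w \<in> ?C}"
      by (intro convex_cone_linear_vimage C linearI) (auto simp: algebra_simps inner_add_right)
  qed
  show ?thesis
    using p
  proof (rule hull_induct)
    fix w assume "w \<in> {w \<in> W. 0 \<le> a \<bullet> w}"
    then show "(a \<bullet> w) *\<^sub>R n - (a \<bullet> n) *\<^sub>R w \<in> ?C" using 1 by auto
  next
    show "convex_cone {p. (a \<bullet> p) *\<^sub>R n - (a \<bullet> n) *\<^sub>R p \<in> ?C}"
      by (intro convex_cone_linear_vimage C linearI) (auto simp: algebra_simps inner_add_right)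
  qed
qed

text \<open>One step of Fourier--Motzkin elimination: every generator produced is an integral
  combination of old ones when \<open>a\<close> and \<open>W\<close> are integral.\<close>

lemma cone_Int_halfspace:
  fixes a :: "'a::real_inner"
  shows "{y \<in> convex_cone hull W. 0 \<le> a \<bullet> y} = convex_cone hull
    ({w\<in>W. 0 \<le> a \<bullet> w} \<union> (\<lambda>(w,w'). (a \<bullet> w) *\<^sub>R w' - (a \<bullet> w') *\<^sub>R w) `
      ({w\<in>W. 0 \<le> a \<bullet> w} \<times> {w\<in>W. a \<bullet> w < 0}))" (is "?L = convex_cone hull (?P \<union> ?N)")
proof (rule antisym; rule subsetI)
  fix y assume "y \<in> ?L"
  then have y: "y \<in> convex_cone hull W" "0 \<le> a \<bullet> y" by auto
  have "W = ?P \<union> {w\<in>W. a \<bullet> w < 0}" by auto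
  then obtain p n where p: "p \<in> convex_cone hull ?P"
    and n: "n \<in> convex_cone hull {w\<in>W. a \<bullet> w < 0}" and ypn: "y = p + n"
    using y(1) convex_cone_hull_Un[of ?P "{w\<in>W. a \<bullet> w < 0}"] by auto
  have pC: "p \<in> convex_cone hull (?P \<union> ?N)"
    using p hull_mono[of ?P "?P \<union> ?N" convex_cone] by auto
  have n0: "a \<bullet> n < 0 \<or> n = 0"
    using n
  proof (rule hull_induct)
    show "convex_cone {n. a \<bullet> n < 0 \<or> n = 0}"
      by (auto simp: convex_cone_iff inner_simps mult_less_0_iff)
  qed auto
  show "y \<in> convex_cone hull (?P \<union> ?N)"
  proof (cases "n = 0")
    case True then show ?thesis using pC ypn by simp
  next
    case False
    with n0 have an: "a \<bullet> n < 0" by simp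
    have le: "- (a \<bullet> n) \<le> a \<bullet> p" using y(2) ypn by (simp add: inner_simps)
    with an have ap: "a \<bullet> p > 0" by linarith
    \<comment> \<open>The eliminated combination, scaled so that it contains \<open>n\<close> once,
      uses up a part of \<open>p\<close>; the remaining share of \<open>p\<close> is nonnegative
      because \<open>0 \<le> a \<bullet> y\<close>.\<close>
    have "y = (1 / (a \<bullet> p)) *\<^sub>R ((a \<bullet> p) *\<^sub>R n - (a \<bullet> n) *\<^sub>R p) + (1 + (a \<bullet> n) / (a \<bullet> p)) *\<^sub>R p"
      using ap by (simp add: ypn algebra_simps)
    also have "\<dots> \<in> convex_cone hull (?P \<union> ?N)"
      using cone_elimination[OF p n] pC ap le
      by (intro convex_cone_hull_add convex_cone_hull_mul) (auto simp: field_simps)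
    finally show ?thesis .
  qed
next
  fix y assume "y \<in> convex_cone hull (?P \<union> ?N)"
  moreover have "convex_cone hull (?P \<union> ?N) \<subseteq> {y \<in> convex_cone hull W. 0 \<le> a \<bullet> y}"
  proof (rule hull_minimal)
    have "convex_cone (convex_cone hull W \<inter> {y. 0 \<le> a \<bullet> y})"
      using convex_cone_Inter[of "{convex_cone hull W, {y. 0 \<le> a \<bullet> y}}"]
        convex_cone_convex_cone_hull convex_cone_halfspace_ge by auto
    then show "convex_cone {y \<in> convex_cone hull W. 0 \<le> a \<bullet> y}"
      by (simp add: Int_def)
    have "(a \<bullet> w) *\<^sub>R w' - (a \<bullet> w') *\<^sub>R w \<in> convex_cone hull W"
      if "w \<in> W" "w' \<in> W" "0 \<le> a \<bullet> w" "a \<bullet> w' < 0" for w w'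
    proof -
      have "(a \<bullet> w) *\<^sub>R w' + (- (a \<bullet> w')) *\<^sub>R w \<in> convex_cone hull W"
        using that by (intro convex_cone_hull_add convex_cone_hull_mul hull_inc) auto
      then show ?thesis by simp
    qed
    then show "?P \<union> ?N \<subseteq> {y \<in> convex_cone hull W. 0 \<le> a \<bullet> y}"
      by (auto intro: hull_inc simp: inner_simps)
  qed
  ultimately show "y \<in> ?L" by blast
qed

text \<open>An integral version of the Minkowski-Weyl theorem: the signed basis vectors generate the
  whole space, and each further constraint is imposed by one elimination step.\<close>

lemma int_cone_generators:
  fixes A :: "'a::euclidean_space set"
  assumes "finite A" and "\<And>a. a \<in> A \<Longrightarrow> int_vec a"
  shows "\<exists>W. finite W \<and> (\<forall>w\<in>W. int_vec w) \<and> {y. \<forall>a\<in>A. 0 \<le> a \<bullet> y} = convex_cone hull W"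
  using assms
proof (induction A)
  case empty
  let ?W = "Basis \<union> uminus ` Basis :: 'a set"
  have "y \<in> convex_cone hull ?W" for y
  proof -
    have "(\<Sum>b\<in>B. (y \<bullet> b) *\<^sub>R b) \<in> convex_cone hull ?W" if "B \<subseteq> Basis" for B
      using finite_subset[OF that finite_Basis] that
    proof (induction B)
      case empty then show ?case by (simp add: convex_cone_hull_contains_0)
    next
      case (insert b B)
      have "(y \<bullet> b) *\<^sub>R b \<in> convex_cone hull ?W"
      proof (cases "0 \<le> y \<bullet> b")
        case True then show ?thesis using insert by (intro convex_cone_hull_mul hull_inc) auto
      next
        case False
        then have "(- (y \<bullet> b)) *\<^sub>R (- b) \<in> convex_cone hull ?W"
          using insert by (intro convex_cone_hull_mul hull_inc) auto
        then show ?thesis by simp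
      qed
      with insert show ?case by (simp add: convex_cone_hull_add)
    qed
    from this[of Basis] show ?thesis by (simp add: euclidean_representation)
  qed
  moreover have "int_vec w" if "w \<in> ?W" for w
    using that by (auto simp: int_vec_def inner_Basis)
  ultimately show ?case by (intro exI[of _ ?W]) auto
next
  case (insert a A)
  then obtain W where W: "finite W" "\<forall>w\<in>W. int_vec w"
    "{y. \<forall>a\<in>A. 0 \<le> a \<bullet> y} = convex_cone hull W" by auto
  let ?W = "{w\<in>W. 0 \<le> a \<bullet> w} \<union> (\<lambda>(w,w'). (a \<bullet> w) *\<^sub>R w' - (a \<bullet> w') *\<^sub>R w) `
      ({w\<in>W. 0 \<le> a \<bullet> w} \<times> {w\<in>W. a \<bullet> w < 0})"
  have "{y. \<forall>c\<in>insert a A. 0 \<le> c \<bullet> y} = {y \<in> convex_cone hull W. 0 \<le> a \<bullet> y}"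
    by (auto simp flip: W(3))
  moreover have "int_vec ((a \<bullet> w) *\<^sub>R w' - (a \<bullet> w') *\<^sub>R w)" if "w \<in> W" "w' \<in> W" for w w'
  proof -
    have "a \<bullet> w \<in> \<int>" "a \<bullet> w' \<in> \<int>"
      using that W(2) insert.prems by (auto intro: int_vec_inner)
    then show ?thesis using that W(2)
      by (auto simp: int_vec_def inner_simps intro: Ints_diff Ints_mult)
  qed
  ultimately show ?case
    using W(1,2) cone_Int_halfspace[of W a] by (intro exI[of _ ?W]) auto
qed

lemma common_denominator:
  assumes "finite A" and "A \<subseteq> (\<rat> :: real set)"
  shows "\<exists>d::nat. 0 < d \<and> (\<forall>q\<in>A. of_nat d * q \<in> \<int>)"
  using assms
proof (induction A)
  case empty then show ?case by (auto intro: exI[of _ 1])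
next
  case (insert q A)
  then obtain d :: nat where d: "0 < d" "\<forall>q\<in>A. of_nat d * q \<in> \<int>" by auto
  from insert.prems have "q \<in> \<rat>" by auto
  then obtain m e :: int where e: "0 < e" "q = of_int m / of_int e"
    by (metis Rats_cases')
  have 1: "of_nat (d * nat e) * q \<in> \<int>" using e by simp
  have 2: "of_nat (d * nat e) * r \<in> \<int>" if "r \<in> A" for r
  proof -
    have "of_int e * (of_nat d * r) \<in> \<int>" using d that by (intro Ints_mult[of "of_int e"]) auto
    moreover have "of_int e * (of_nat d * r) = of_nat (d * nat e) * r" using e by simp
    ultimately show ?thesis by metis
  qed
  show ?case using 1 2 d e by (intro exI[of _ "d * nat e"]) auto
qed

text \<open>The valid pairs \<open>(a, b)\<close> form a cone with one constraint for each point of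
  \<open>V\<close>, and clearing the denominators of that point makes the constraint integral.
  Integrality of \<open>W\<close> later lets its members act as splits.\<close>

lemma rational_polytope_valid_inequalities:
  fixes V :: "(real^'n) set"
  assumes "finite V" and "\<And>v. v \<in> V \<Longrightarrow> rat_point v"
  obtains W :: "((real^'n) \<times> real) set" where "finite W"
    and "\<And>a b. (a, b) \<in> W \<Longrightarrow> int_point a \<and> b \<in> \<int>"
    and "\<And>a b. (\<forall>v\<in>V. a \<bullet> v \<le> b) \<longleftrightarrow> (a, b) \<in> convex_cone hull W"
proof -
  have "\<exists>d::nat. 0 < d \<and> (\<forall>i. of_nat d * v $ i \<in> \<int>)" if "v \<in> V" for v
    using common_denominator[of "range (($) v)"] assms(2)[OF that] by (auto simp: rat_point_def)
  then obtain d :: "real^'n \<Rightarrow> nat"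
    where d: "\<And>v. v \<in> V \<Longrightarrow> 0 < d v" "\<And>v i. v \<in> V \<Longrightarrow> of_nat (d v) * v $ i \<in> \<int>"
    by metis
  let ?A = "(\<lambda>v. (- (of_nat (d v) *\<^sub>R v), of_nat (d v)) :: (real^'n) \<times> real) ` V"
  have "\<exists>W. finite W \<and> (\<forall>w\<in>W. int_vec w) \<and> {y. \<forall>a\<in>?A. 0 \<le> a \<bullet> y} = convex_cone hull W"
    using assms(1) d(2) by (intro int_cone_generators) (auto simp: int_vec_Pair int_point_def)
  then obtain W where W: "finite W" "\<And>w. w \<in> W \<Longrightarrow> int_vec w"
    "{y. \<forall>a\<in>?A. 0 \<le> a \<bullet> y} = convex_cone hull W" by blast
  have "(\<forall>v\<in>V. a \<bullet> v \<le> b) \<longleftrightarrow> (a, b) \<in> convex_cone hull W" for a b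
  proof -
    have "0 \<le> (- (of_nat (d v) *\<^sub>R v), of_nat (d v)) \<bullet> (a, b) \<longleftrightarrow> a \<bullet> v \<le> b" if "v \<in> V" for v
    proof -
      have "(- (of_nat (d v) *\<^sub>R v), of_nat (d v)) \<bullet> (a, b) = of_nat (d v) * (b - a \<bullet> v)"
        by (simp add: inner_commute algebra_simps)
      then show ?thesis using d(1)[OF that] by (simp add: zero_le_mult_iff)
    qed
    then show ?thesis by (auto simp flip: W(3))
  qed
  with W show thesis by (intro that[of W]) (auto simp: int_vec_Pair)
qed

text \<open>If \<open>W\<close> generates the inequalities valid for a polytope, this plays the role of the distance to
  the polytope: it dominates every affine function that is nonpositive there, up to a factor.\<close>

definition excess :: "((real^'n) \<times> real) set \<Rightarrow> real^'n \<Rightarrow> real" where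
  "excess W x = Max (insert 0 ((\<lambda>(a, b). a \<bullet> x - b) ` W))"

lemma excess_nonneg: "finite W \<Longrightarrow> 0 \<le> excess W x"
  by (simp add: excess_def)

lemma excess_ge: "finite W \<Longrightarrow> (a, b) \<in> W \<Longrightarrow> a \<bullet> x - b \<le> excess W x"
  unfolding excess_def by (rule Max_ge) (auto intro!: rev_image_eqI)

lemma excess_le_iff:
  "finite W \<Longrightarrow> excess W x \<le> y \<longleftrightarrow> 0 \<le> y \<and> (\<forall>(a, b)\<in>W. a \<bullet> x - b \<le> y)"
  by (auto simp: excess_def)

lemma closed_excess_ge:
  assumes "finite W" shows "closed {x. y \<le> excess W x}"
proof -
  have "{x. y \<le> excess W x} = {x. y \<le> 0} \<union> (\<Union>(a, b)\<in>W. {x. y + b \<le> a \<bullet> x})"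
    using assms by (force simp: excess_def Max_ge_iff algebra_simps)
  moreover have "closed (\<Union>(a, b)\<in>W. {x. y + b \<le> a \<bullet> x})"
    using assms by (intro closed_UN) (auto intro: closed_halfspace_ge)
  ultimately show ?thesis by (auto intro: closed_Un)
qed

text \<open>The pairs whose affine function is bounded by some nonnegative multiple of
  \<open>excess W\<close> form a convex cone, and every generator satisfies the bound with factor
  1.\<close>

lemma cone_le_excess:
  assumes "finite W" and "(a, b) \<in> convex_cone hull W"
  obtains \<Lambda> where "0 \<le> \<Lambda>" and "\<And>x. a \<bullet> x - b \<le> \<Lambda> * excess W x"
proof -
  let ?P = "\<lambda>w. \<exists>\<Lambda>\<ge>0. \<forall>x. fst w \<bullet> x - snd w \<le> \<Lambda> * excess W x"
  have "?P (a, b)"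
    using assms(2)
  proof (rule hull_induct)
    fix w assume "w \<in> W"
    then show "?P w" using excess_ge[OF assms(1), of "fst w" "snd w"]
      by (intro exI[of _ 1]) auto
  next
    show "convex_cone {w. ?P w}"
      unfolding convex_cone_iff
    proof (intro conjI ballI allI impI; clarify)
      show "?P 0" by (intro exI[of _ 0]) auto
    next
      fix a b c d \<Lambda> \<Lambda>' assume *: "0 \<le> \<Lambda>" "0 \<le> \<Lambda>'"
        "\<forall>x. fst (a, b) \<bullet> x - snd (a, b) \<le> \<Lambda> * excess W x" "\<forall>x. fst (c, d) \<bullet> x - snd (c, d) \<le> \<Lambda>' * excess W x"
      have "(a + c) \<bullet> x - (b + d) \<le> (\<Lambda> + \<Lambda>') * excess W x" for x
        using *(3,4)[rule_format, of x] by (simp add: inner_simps algebra_simps)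
      with * show "?P ((a, b) + (c, d))" by (intro exI[of _ "\<Lambda> + \<Lambda>'"]) auto
    next
      fix a b \<Lambda> and t :: real
      assume *: "0 \<le> \<Lambda>" "\<forall>x. fst (a, b) \<bullet> x - snd (a, b) \<le> \<Lambda> * excess W x" "0 \<le> t"
      have "(t *\<^sub>R a) \<bullet> x - t * b \<le> (t * \<Lambda>) * excess W x" for x
        using mult_left_mono[OF *(2)[rule_format, of x] *(3)] by (simp add: algebra_simps)
      with * show "?P (t *\<^sub>R (a, b))" by (intro exI[of _ "t * \<Lambda>"]) auto
    qed
  qed
  with that show thesis by auto
qed

text \<open>A point outside the hull is cut off by a valid inequality. This lies in the cone, so its
  violation at \<open>x\<close> forces \<open>excess W x\<close> to be positive.\<close>

lemma valid_inequalities_mem_hull: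
  fixes V :: "(real^'n) set"
  assumes "finite V" "finite W"
    and W: "\<And>a b. (\<forall>v\<in>V. a \<bullet> v \<le> b) \<longleftrightarrow> (a, b) \<in> convex_cone hull W"
  shows "x \<in> convex hull V \<longleftrightarrow> excess W x \<le> 0"
proof
  assume "x \<in> convex hull V"
  moreover have "convex hull V \<subseteq> {x. a \<bullet> x \<le> b}" if "(a, b) \<in> W" for a b
    using W[of a b] that by (intro hull_minimal) (auto intro: hull_inc convex_halfspace_le)
  ultimately show "excess W x \<le> 0" using \<open>finite W\<close> by (auto simp: excess_le_iff)
next
  assume x: "excess W x \<le> 0"
  show "x \<in> convex hull V"
  proof (rule ccontr)
    assume "x \<notin> convex hull V"
    then obtain a b where ab: "a \<bullet> x < b" "\<forall>y\<in>convex hull V. a \<bullet> y > b"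
      using separating_hyperplane_closed_point[of "convex hull V" x] \<open>finite V\<close>
      by (auto simp: finite_imp_compact_convex_hull compact_imp_closed)
    then have "(- a, - b) \<in> convex_cone hull W"
      by (simp flip: W) (meson hull_inc less_imp_le)
    then obtain \<Lambda> where "0 \<le> \<Lambda>" "\<And>x. - a \<bullet> x - (- b) \<le> \<Lambda> * excess W x"
      using cone_le_excess[OF \<open>finite W\<close>] by blast
    moreover from this(1) x have "\<Lambda> * excess W x \<le> 0" by (simp add: mult_nonneg_nonpos)
    ultimately show False using ab(1) by (smt (verit) inner_minus_left)
  qed
qed

lemma excess_cases:
  assumes "finite W"
  obtains "excess W x = 0" | a b where "(a, b) \<in> W" "excess W x = a \<bullet> x - b"
proof -
  have "excess W x \<in> insert 0 ((\<lambda>(a, b). a \<bullet> x - b) ` W)"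
    unfolding excess_def using assms by (intro Max_in) auto
  with that show thesis by auto
qed

subsection \<open>Sets fixed by unit splits\<close>

text \<open>Invariance under the splits along coordinate directions, which already suffice to find
  integer points. Open segments make the condition pass to faces.\<close>

definition split_fixed :: "(real^'n) set \<Rightarrow> bool" where
  "split_fixed C \<longleftrightarrow> (\<forall>x\<in>C. \<forall>i. \<forall>n\<in>\<int>. n < x $ i \<and> x $ i < n + 1 \<longrightarrow>
     (\<exists>y\<in>C. \<exists>z\<in>C. y $ i \<le> n \<and> n + 1 \<le> z $ i \<and> x \<in> open_segment y z))"

text \<open>A linear function that attains its maximum at an inner point of a segment is constant on
  the segment, so both end points stay in the face.\<close>

lemma split_fixed_face:
  assumes C: "split_fixed C" and le: "\<And>x. x \<in> C \<Longrightarrow> g \<bullet> x \<le> \<gamma>"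
  shows "split_fixed {x \<in> C. g \<bullet> x = \<gamma>}"
  unfolding split_fixed_def
proof (intro ballI allI impI)
  fix x i n assume x: "x \<in> {x \<in> C. g \<bullet> x = \<gamma>}" and n: "n \<in> \<int>" "n < x $ i \<and> x $ i < n + 1"
  then obtain y z where yz: "y \<in> C" "z \<in> C" "y $ i \<le> n" "n + 1 \<le> z $ i" "x \<in> open_segment y z"
    using C unfolding split_fixed_def by blast
  then obtain u where u: "0 < u" "u < 1" "x = (1 - u) *\<^sub>R y + u *\<^sub>R z"
    by (auto simp: in_segment)
  then have "(1 - u) * (g \<bullet> y) + u * (g \<bullet> z) = \<gamma>" using x by (simp add: inner_simps)
  moreover have "(1 - u) * (g \<bullet> y) \<le> (1 - u) * \<gamma>" "u * (g \<bullet> z) \<le> u * \<gamma>"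
    using le yz u by (auto intro!: mult_left_mono)
  moreover have "(1 - u) * \<gamma> + u * \<gamma> = \<gamma>" by (simp add: algebra_simps)
  ultimately have "(1 - u) * (g \<bullet> y) = (1 - u) * \<gamma>" "u * (g \<bullet> z) = u * \<gamma>" by linarith+
  with u yz show "\<exists>y\<in>{x \<in> C. g \<bullet> x = \<gamma>}. \<exists>z\<in>{x \<in> C. g \<bullet> x = \<gamma>}.
      y $ i \<le> n \<and> n + 1 \<le> z $ i \<and> x \<in> open_segment y z"
    by auto
qed

lemma compact_argmax_face:
  fixes C :: "'a::euclidean_space set"
  assumes "compact C" "C \<noteq> {}"
  obtains \<gamma> where "\<And>x. x \<in> C \<Longrightarrow> g \<bullet> x \<le> \<gamma>" "compact {x \<in> C. g \<bullet> x = \<gamma>}" "{x \<in> C. g \<bullet> x = \<gamma>} \<noteq> {}"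
proof -
  obtain x where x: "x \<in> C" "\<forall>y\<in>C. g \<bullet> y \<le> g \<bullet> x"
    using continuous_attains_sup[OF assms, of "\<lambda>x. g \<bullet> x"]
      continuous_on_inner[OF continuous_on_const continuous_on_id, of C g] by auto
  moreover have "compact (C \<inter> {y. g \<bullet> y = g \<bullet> x})"
    using assms by (intro compact_Int_closed closed_hyperplane)
  ultimately show thesis by (intro that[of "g \<bullet> x"]) (auto simp: Int_def)
qed

text \<open>Maximise the coordinates one after the other: each maximum must be an integer, and the set of
  maximisers is again fixed.\<close>

lemma split_fixed_int_point:
  fixes C :: "(real^'n) set"
  assumes "compact C" "C \<noteq> {}" "split_fixed C"
  shows "\<exists>x\<in>C. int_point x"
proof -
  have "\<exists>C'\<subseteq>C. compact C' \<and> C' \<noteq> {} \<and> split_fixed C' \<and> (\<forall>x\<in>C'. \<forall>i\<in>I. x $ i \<in> \<int>)"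
    for I :: "'n set"
    using finite_class.finite[of I]
  proof (induction I)
    case empty then show ?case using assms by auto
  next
    case (insert j I)
    then obtain C' where C': "C' \<subseteq> C" "compact C'" "C' \<noteq> {}" "split_fixed C'"
      "\<forall>x\<in>C'. \<forall>i\<in>I. x $ i \<in> \<int>" by auto
    obtain \<gamma> where \<gamma>: "\<And>x. x \<in> C' \<Longrightarrow> axis j 1 \<bullet> x \<le> \<gamma>" "compact {x \<in> C'. axis j 1 \<bullet> x = \<gamma>}"
      "{x \<in> C'. axis j 1 \<bullet> x = \<gamma>} \<noteq> {}"
      using compact_argmax_face[OF C'(2,3)] by blast
    then obtain x where x: "x \<in> C'" "x $ j = \<gamma>" by (auto simp: inner_axis')
    \<comment> \<open>If the maximum were fractional, the invariance would supply a point whose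
      coordinate reaches the next integer.\<close>
    have "\<gamma> \<in> \<int>"
    proof (rule ccontr)
      assume "\<gamma> \<notin> \<int>"
      then have "of_int \<lfloor>\<gamma>\<rfloor> < \<gamma>" "\<gamma> < of_int \<lfloor>\<gamma>\<rfloor> + 1"
        by (metis Ints_of_int of_int_floor_le order_le_less) linarith
      then obtain z where "z \<in> C'" "of_int \<lfloor>\<gamma>\<rfloor> + 1 \<le> z $ j"
        using C'(4) x unfolding split_fixed_def by (meson Ints_of_int)
      with \<gamma>(1)[of z] show False by (simp add: inner_axis') linarith
    qed
    then show ?case
      using C'(1,5) \<gamma>(2,3) split_fixed_face[OF C'(4) \<gamma>(1)]
      by (intro exI[of _ "{x \<in> C'. axis j 1 \<bullet> x = \<gamma>}"]) (auto simp: inner_axis')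
  qed
  from this[of UNIV] show ?thesis unfolding int_point_def by blast
qed

section \<open>Split hulls and the split closure\<close>

lemma split_hull_mono: "K \<subseteq> K' \<Longrightarrow> split_hull K \<pi> \<pi>0 \<subseteq> split_hull K' \<pi> \<pi>0"
  unfolding split_hull_def by (intro hull_mono) auto

lemma split_hull_subset: "convex K \<Longrightarrow> split_hull K \<pi> \<pi>0 \<subseteq> K"
  unfolding split_hull_def by (intro hull_minimal) auto

lemma split_closure_mono:
  assumes "K \<subseteq> K'" shows "split_closure K \<subseteq> split_closure K'"
  using split_hull_mono[OF assms] unfolding split_closure_def by blast

lemma convex_split_closure: "convex (split_closure K)"
  unfolding split_closure_def split_hull_def by (intro convex_Inter) auto

lemma is_split_axis: "n \<in> \<int> \<Longrightarrow> is_split (axis i 1) n"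
  by (auto simp: is_split_def int_point_def axis_def vec_eq_iff)

text \<open>Such a point lies on a segment joining the two sides; the segment crosses both
  hyperplanes, and the crossing points are in \<open>K\<close> by convexity. The weights are
  explicit because their continuity in \<open>p\<close> is needed for passing to limits.\<close>

lemma split_hull_point_on_hyperplanes:
  assumes K: "convex K" and p: "p \<in> split_hull K \<pi> \<pi>0"
    and p0: "\<pi>0 < \<pi> \<bullet> fst p" "\<pi> \<bullet> fst p < \<pi>0 + 1"
  obtains q r where "q \<in> K" "r \<in> K" "\<pi> \<bullet> fst q = \<pi>0" "\<pi> \<bullet> fst r = \<pi>0 + 1"
    and "p = (\<pi>0 + 1 - \<pi> \<bullet> fst p) *\<^sub>R q + (\<pi> \<bullet> fst p - \<pi>0) *\<^sub>R r"
proof -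
  let ?h = "\<lambda>p. \<pi> \<bullet> fst p"
  let ?A = "K \<inter> {p. ?h p \<le> \<pi>0}" and ?B = "K \<inter> {p. ?h p \<ge> \<pi>0 + 1}"
  have lin: "?h (a *\<^sub>R q + b *\<^sub>R r) = a * ?h q + b * ?h r" for a b q r
    by (simp add: inner_simps)
  have cA: "convex ?A"
    using convex_halfspace_le[of "(\<pi>, 0)" \<pi>0] K by (intro convex_Int) (auto simp: inner_prod_def)
  have cB: "convex ?B"
    using convex_halfspace_ge[of "\<pi>0 + 1" "(\<pi>, 0)"] K by (intro convex_Int) (auto simp: inner_prod_def)
  \<comment> \<open>If one side were empty, the hull would be the other side alone, which misses the
    points strictly between the hyperplanes.\<close>
  have neA: "?A \<noteq> {}"
  proof
    assume "?A = {}"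
    then have "p \<in> ?B" using p cB hull_same[of convex ?B] unfolding split_hull_def by simp
    with p0 show False by simp
  qed
  have neB: "?B \<noteq> {}"
  proof
    assume "?B = {}"
    then have "p \<in> ?A" using p cA hull_same[of convex ?A] unfolding split_hull_def by simp
    with p0 show False by simp
  qed
  obtain q r v u where q: "q \<in> ?A" and r: "r \<in> ?B" and "v + u = 1"
    and "p = v *\<^sub>R q + u *\<^sub>R r"
    using p unfolding split_hull_def convex_hull_union_two[OF cA neA cB neB] by blast
  then have p_eq: "p = (1 - u) *\<^sub>R q + u *\<^sub>R r" by (metis add_diff_cancel_right')
  define s where "s t = (1 - t) *\<^sub>R q + t *\<^sub>R r" for t
  have hs: "?h (s t) = ?h q + t * (?h r - ?h q)" for t
    unfolding s_def lin by (simp add: algebra_simps)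
  have d: "?h r - ?h q > 0" using q r by auto
  \<comment> \<open>The parameters at which the segment from \<open>q\<close> to \<open>r\<close>
    meets the two hyperplanes.\<close>
  define t1 where "t1 = (\<pi>0 - ?h q) / (?h r - ?h q)"
  define t2 where "t2 = (\<pi>0 + 1 - ?h q) / (?h r - ?h q)"
  have t: "0 \<le> t1" "t1 \<le> 1" "0 \<le> t2" "t2 \<le> 1"
    using q r d by (auto simp: t1_def t2_def field_simps)
  have sK: "s t \<in> K" if "0 \<le> t" "t \<le> 1" for t
    using q r K that unfolding s_def by (simp add: convexD)
  have h1: "?h (s t1) = \<pi>0" and h2: "?h (s t2) = \<pi>0 + 1"
    using d by (auto simp: hs t1_def t2_def)
  have hp: "?h p = ?h q + u * (?h r - ?h q)"
    using hs[of u] p_eq by (simp add: s_def)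
  have "(\<pi>0 + 1 - ?h p) * t1 + (?h p - \<pi>0) * t2 = u"
  proof -
    have "(\<pi>0 + 1 - ?h p) * t1 + (?h p - \<pi>0) * t2 =
        ((\<pi>0 + 1 - ?h p) * (\<pi>0 - ?h q) + (?h p - \<pi>0) * (\<pi>0 + 1 - ?h q)) / (?h r - ?h q)"
      unfolding t1_def t2_def by (simp add: add_divide_distrib)
    also have "(\<pi>0 + 1 - ?h p) * (\<pi>0 - ?h q) + (?h p - \<pi>0) * (\<pi>0 + 1 - ?h q) = ?h p - ?h q"
      by (simp add: algebra_simps)
    also have "(?h p - ?h q) / (?h r - ?h q) = u" using d hp by simp
    finally show ?thesis .
  qed
  moreover have "a *\<^sub>R s t1 + b *\<^sub>R s t2 = s (a * t1 + b * t2)" if "a + b = 1" for a b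
  proof -
    have "a *\<^sub>R q + b *\<^sub>R q = q" using that by (metis scaleR_add_left scaleR_one)
    then show ?thesis by (simp add: s_def algebra_simps)
  qed
  ultimately have "p = (\<pi>0 + 1 - ?h p) *\<^sub>R s t1 + (?h p - \<pi>0) *\<^sub>R s t2"
    using p_eq by (simp add: s_def[of u])
  with sK t h1 h2 that show thesis by blast
qed

subsection \<open>Chains of split closures and their limits\<close>

text \<open>The closures make compactness arguments available; the chain only has to contain the iterated
  split closures.\<close>

locale split_chain =
  fixes K :: "nat \<Rightarrow> ((real^'n) \<times> real) set"
  assumes closed_K: "closed (K k)" and convex_K: "convex (K k)"
    and K_step: "is_split \<pi> \<pi>0 \<Longrightarrow> K (Suc k) \<subseteq> closure (split_hull (K k) \<pi> \<pi>0)"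
    and compact_above: "compact {p \<in> K 0. s \<le> snd p}"
begin

lemma K_antimono: "m \<le> n \<Longrightarrow> K n \<subseteq> K m"
proof (rule lift_Suc_antimono_le)
  fix k
  \<comment> \<open>Any split shows the inclusion; the coordinate \<open>undefined\<close> and the
    value 0 are arbitrary.\<close>
  have "closure (split_hull (K k) (axis undefined 1) 0) \<subseteq> K k"
    using split_hull_subset[OF convex_K] closed_K by (intro closure_minimal)
  then show "K (Suc k) \<subseteq> K k"
    using K_step[OF is_split_axis[OF Ints_0], of k undefined] by blast
qed

text \<open>The region below the graph of an affine function is a closed half-space, so a bound on
  the two outer parts survives the convex hull and the closure.\<close>

lemma affine_bound_step:
  assumes "is_split \<pi> \<pi>0"
    and off: "\<And>x z. (x, z) \<in> K k \<Longrightarrow> \<pi> \<bullet> x \<le> \<pi>0 \<or> \<pi>0 + 1 \<le> \<pi> \<bullet> x \<Longrightarrow> z \<le> a \<bullet> x + b"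
    and p: "(x, z) \<in> K (Suc k)"
  shows "z \<le> a \<bullet> x + b"
proof -
  have eq: "{p. snd p \<le> a \<bullet> fst p + b} = {p. (- a, 1) \<bullet> p \<le> b}"
    by (auto simp: inner_prod_def algebra_simps)
  have "split_hull (K k) \<pi> \<pi>0 \<subseteq> {p. snd p \<le> a \<bullet> fst p + b}"
    unfolding split_hull_def
  proof (rule hull_minimal)
    show "convex {p. snd p \<le> a \<bullet> fst p + b}" unfolding eq by (rule convex_halfspace_le)
  qed (use off in auto)
  then have "closure (split_hull (K k) \<pi> \<pi>0) \<subseteq> {p. snd p \<le> a \<bullet> fst p + b}"
    unfolding eq by (intro closure_minimal closed_halfspace_le)
  then have "(x, z) \<in> {p. snd p \<le> a \<bullet> fst p + b}" using K_step[OF assms(1), of k] p by blast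
  then show ?thesis by simp
qed

lemma K_bounded_above: "\<exists>B. \<forall>p\<in>K 0. snd p \<le> B"
proof (cases "{p \<in> K 0. 0 \<le> snd p} = {}")
  case True then show ?thesis by (intro exI[of _ 0]) force
next
  case False
  obtain q where "q \<in> {p \<in> K 0. 0 \<le> snd p}" "\<forall>p\<in>{p \<in> K 0. 0 \<le> snd p}. snd p \<le> snd q"
    using continuous_attains_sup[OF compact_above[of 0] False continuous_on_snd[OF continuous_on_id]]
    by blast
  then show ?thesis by (intro exI[of _ "snd q"]) force
qed

text \<open>Since heights on \<open>E\<close> are bounded below, the sets
  \<open>K k \<inter> E\<close> are compact and nested; if they were all nonempty, so would be their
  intersection.\<close>

lemma eventually_disjoint:
  assumes E: "closed E" "\<And>p. p \<in> E \<Longrightarrow> s \<le> snd p" and dis: "(\<Inter>k. K k) \<inter> E = {}"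
  shows "\<exists>k. K k \<inter> E = {}"
proof (rule ccontr)
  assume *: "\<nexists>k. K k \<inter> E = {}"
  have "\<Inter>(range (\<lambda>k. K k \<inter> E)) \<noteq> {}"
  proof (rule compact_nest)
    fix k :: nat
    have "K k \<inter> E = {p \<in> K 0. s \<le> snd p} \<inter> (K k \<inter> E)"
      using K_antimono[of 0 k] E(2) by auto
    also have "compact \<dots>" using closed_K E(1) compact_above
      by (intro compact_Int_closed closed_Int)
    finally show "compact (K k \<inter> E)" .
  qed (use * K_antimono in blast)+
  with dis show False by auto
qed

text \<open>A point at the top level is a limit of points of the split hulls. Each of these is a
  mean of two points on the hyperplanes, and a subsequence of those pairs converges to two points of
  the limit set. Their mean has the top height, so both do.\<close>

lemma top_level_split_fixed:
  assumes top: "\<And>p. p \<in> (\<Inter>k. K k) \<Longrightarrow> snd p \<le> h"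
  shows "split_fixed {x. (x, h) \<in> (\<Inter>k. K k)}"
  unfolding split_fixed_def
proof (intro ballI allI impI)
  fix x i n
  assume "x \<in> {x. (x, h) \<in> (\<Inter>k. K k)}" and n: "n \<in> \<int>" and xn: "n < x $ i \<and> x $ i < n + 1"
  then have x: "(x, h) \<in> K k" for k by auto
  let ?e = "axis i 1 :: real^'n"
  obtain B where B: "\<And>p. p \<in> K 0 \<Longrightarrow> snd p \<le> B" "0 \<le> B"
    using K_bounded_above by (metis linorder_linear order_trans)
  \<comment> \<open>Half the distance to the nearer hyperplane, so that the weights
    \<open>u k\<close> stay away from 0 and 1.\<close>
  define e where "e = min (x $ i - n) (n + 1 - x $ i) / 2"
  have e: "0 < e" using xn by (auto simp: e_def)
  have "\<exists>p. p \<in> split_hull (K k) ?e n \<and> dist p (x, h) < min e (inverse (Suc k))" for k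
  proof -
    have "(x, h) \<in> closure (split_hull (K k) ?e n)" using x K_step[OF is_split_axis[OF n]] by blast
    then show ?thesis unfolding closure_approachable using e by (metis inverse_positive_iff_positive
        min_less_iff_conj of_nat_0_less_iff zero_less_Suc)
  qed
  then obtain p where p: "\<And>k. p k \<in> split_hull (K k) ?e n"
    and pd: "\<And>k. dist (p k) (x, h) < min e (inverse (Suc k))" by metis
  define u where "u k = fst (p k) $ i - n" for k
  have "\<bar>fst (p k) $ i - x $ i\<bar> < e" "\<bar>snd (p k) - h\<bar> < inverse (Suc k)" for k
  proof -
    have "\<bar>fst (p k) $ i - x $ i\<bar> \<le> dist (fst (p k)) x"
      using component_le_norm_cart[of "fst (p k) - x" i] by (simp add: dist_norm)
    also have "\<dots> \<le> dist (p k) (x, h)" using dist_fst_le[of "p k" "(x, h)"] by simp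
    finally show "\<bar>fst (p k) $ i - x $ i\<bar> < e" using pd[of k] by simp
    have "\<bar>snd (p k) - h\<bar> \<le> dist (p k) (x, h)"
      using dist_snd_le[of "p k" "(x, h)"] by (simp add: dist_real_def)
    then show "\<bar>snd (p k) - h\<bar> < inverse (Suc k)" using pd[of k] by simp
  qed note near = this
  have u: "e < u k" "e < 1 - u k" for k
  proof -
    have "2 * e \<le> x $ i - n" "2 * e \<le> n + 1 - x $ i" by (auto simp: e_def)
    then show "e < u k" "e < 1 - u k" using near(1)[of k] unfolding u_def by linarith+
  qed
  have "\<exists>q r. q \<in> K k \<and> r \<in> K k \<and> fst q $ i = n \<and> fst r $ i = n + 1 \<and>
      p k = (1 - u k) *\<^sub>R q + u k *\<^sub>R r" for k
  proof -
    have e_in: "?e \<bullet> y = y $ i" for y by (simp add: inner_axis')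
    have "n < ?e \<bullet> fst (p k)" "?e \<bullet> fst (p k) < n + 1" using u[of k] e by (auto simp: e_in u_def)
    from split_hull_point_on_hyperplanes[OF convex_K p this]
    obtain q r where qr: "q \<in> K k" "r \<in> K k" "fst q $ i = n" "fst r $ i = n + 1"
      "p k = (n + 1 - fst (p k) $ i) *\<^sub>R q + (fst (p k) $ i - n) *\<^sub>R r"
      unfolding e_in by metis
    moreover have "n + 1 - fst (p k) $ i = 1 - u k" "fst (p k) $ i - n = u k"
      by (auto simp: u_def)
    ultimately show ?thesis by metis
  qed
  then obtain q r where qr: "\<And>k. q k \<in> K k" "\<And>k. r k \<in> K k" "\<And>k. fst (q k) $ i = n"
      "\<And>k. fst (r k) $ i = n + 1" "\<And>k. p k = (1 - u k) *\<^sub>R q k + u k *\<^sub>R r k" by metis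
  \<comment> \<open>A lower bound for the heights of all end points: each has weight more than
    \<open>e\<close>, the other end is at most \<open>B\<close> high, and the mean is at least
    \<open>h - 1\<close>. It confines the end points to a compact set.\<close>
  define s where "s = - \<bar>h - 1 - B\<bar> / e"
  have low: "s \<le> z1" if "e < v" "e < 1 - v" "h - 1 \<le> v * z1 + (1 - v) * z2" "z2 \<le> B" for v z1 z2 :: real
  proof -
    have "(1 - v) * z2 \<le> (1 - v) * B" using that e by (intro mult_left_mono) auto
    moreover have "(1 - v) * B \<le> B" using that e B(2) by (simp add: mult_left_le_one_le)
    ultimately have "- \<bar>h - 1 - B\<bar> \<le> v * z1" using that(3) by linarith
    moreover have "e * s = - \<bar>h - 1 - B\<bar>" using e by (simp add: s_def)
    moreover have "v * s \<le> e * s" using that(1) e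
      by (intro mult_right_mono_neg) (auto simp: s_def)
    ultimately have "v * s \<le> v * z1" by linarith
    then show ?thesis using that(1) e by simp
  qed
  have sp: "snd (p k) = (1 - u k) * snd (q k) + u k * snd (r k)" for k by (simp add: qr(5))
  have ph: "h - 1 \<le> snd (p k)" for k
  proof -
    have "inverse (real (Suc k)) \<le> 1" by (simp add: field_simps)
    then show ?thesis using near(2)[of k] by linarith
  qed
  have q0: "q k \<in> K 0" "r k \<in> K 0" for k using qr(1,2) K_antimono[of 0 k] by auto
  have "s \<le> snd (q k)" "s \<le> snd (r k)" for k
    using low[of "1 - u k" "snd (q k)" "snd (r k)"] low[of "u k" "snd (r k)" "snd (q k)"]
      u[of k] ph[of k] B(1) q0[of k] sp[of k] by (auto simp: add.commute)
  with q0 have "(q k, r k) \<in> {p \<in> K 0. s \<le> snd p} \<times> {p \<in> K 0. s \<le> snd p}" for k by auto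
  then obtain l \<phi> where \<phi>: "strict_mono (\<phi> :: nat \<Rightarrow> nat)" and lim: "((\<lambda>k. (q k, r k)) \<circ> \<phi>) \<longlonglongrightarrow> l"
    using seq_compactE[OF compact_imp_seq_compact[OF compact_Times[OF compact_above compact_above]],
        of "\<lambda>k. (q k, r k)" s s] by blast
  define q' r' where "q' = fst l" and "r' = snd l"
  have limq: "(\<lambda>k. q (\<phi> k)) \<longlonglongrightarrow> q'" and limr: "(\<lambda>k. r (\<phi> k)) \<longlonglongrightarrow> r'"
    using tendsto_fst[OF lim] tendsto_snd[OF lim] by (simp_all add: o_def q'_def r'_def)
  have inK: "q' \<in> K j" "r' \<in> K j" for j
  proof -
    have *: "eventually (\<lambda>k. q (\<phi> k) \<in> K j \<and> r (\<phi> k) \<in> K j) sequentially"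
      using eventually_ge_at_top[of j]
    proof eventually_elim
      case (elim k)
      then have "j \<le> \<phi> k" using seq_suble[OF \<phi>, of k] by simp
      then show ?case using qr(1,2) K_antimono by blast
    qed
    show "q' \<in> K j" "r' \<in> K j"
      using Lim_in_closed_set[OF closed_K _ _ limq] Lim_in_closed_set[OF closed_K _ _ limr]
        eventually_conj_iff[THEN iffD1, OF *] by auto
  qed
  have limp: "(\<lambda>k. p (\<phi> k)) \<longlonglongrightarrow> (x, h)"
  proof -
    have "p \<longlonglongrightarrow> (x, h)"
    proof (rule metric_tendsto_imp_tendsto[OF LIMSEQ_inverse_real_of_nat])
      show "\<forall>\<^sub>F k in sequentially. dist (p k) (x, h) \<le> dist (inverse (real (Suc k))) 0"
        using pd by (intro always_eventually) (simp add: less_imp_le)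
    qed
    from LIMSEQ_subseq_LIMSEQ[OF this \<phi>] show ?thesis by (simp add: o_def)
  qed
  let ?u = "x $ i - n"
  have limu: "(\<lambda>k. u (\<phi> k)) \<longlonglongrightarrow> ?u"
    unfolding u_def using tendsto_vec_nth[OF tendsto_fst[OF limp]] by (auto intro: tendsto_intros)
  have "(\<lambda>k. (1 - u (\<phi> k)) *\<^sub>R q (\<phi> k) + u (\<phi> k) *\<^sub>R r (\<phi> k)) \<longlonglongrightarrow> (1 - ?u) *\<^sub>R q' + ?u *\<^sub>R r'"
    by (intro tendsto_intros limu limq limr)
  then have eq: "(x, h) = (1 - ?u) *\<^sub>R q' + ?u *\<^sub>R r'"
    using limp LIMSEQ_unique by (simp flip: qr(5))
  \<comment> \<open>A mean with positive weights of two heights at most \<open>h\<close> equals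
    \<open>h\<close> only if both do.\<close>
  have h_eq: "(1 - ?u) * snd q' + ?u * snd r' = h" using arg_cong[OF eq, of snd] by simp
  moreover have "(1 - ?u) * snd q' \<le> (1 - ?u) * h" "?u * snd r' \<le> ?u * h"
    using top inK xn by (auto intro!: mult_left_mono)
  moreover have "(1 - ?u) * h + ?u * h = h" by (simp add: algebra_simps)
  ultimately have "(1 - ?u) * snd q' = (1 - ?u) * h" "?u * snd r' = ?u * h" by linarith+
  then have snd: "snd q' = h" "snd r' = h" using xn by auto
  have "(\<lambda>k. fst (q (\<phi> k)) $ i) \<longlonglongrightarrow> fst q' $ i" "(\<lambda>k. fst (r (\<phi> k)) $ i) \<longlonglongrightarrow> fst r' $ i"
    by (intro tendsto_intros limq limr)+
  then have fst: "fst q' $ i = n" "fst r' $ i = n + 1"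
    unfolding qr(3,4) by (auto simp: LIMSEQ_const_iff)
  have "x = (1 - ?u) *\<^sub>R fst q' + ?u *\<^sub>R fst r'" using arg_cong[OF eq, of fst] by simp
  moreover have "fst q' \<noteq> fst r'" using fst by auto
  ultimately have "x \<in> open_segment (fst q') (fst r')"
    using xn by (auto simp: in_segment intro!: exI[of _ ?u])
  moreover have "(fst q', h) \<in> K j" "(fst r', h) \<in> K j" for j
    using inK[of j] snd by (metis prod.collapse)+
  ultimately show "\<exists>y\<in>{x. (x, h) \<in> (\<Inter>k. K k)}. \<exists>z\<in>{x. (x, h) \<in> (\<Inter>k. K k)}.
      y $ i \<le> n \<and> n + 1 \<le> z $ i \<and> x \<in> open_segment y z"
    using fst by (intro bexI[of _ "fst q'"] bexI[of _ "fst r'"]) auto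
qed

lemma compact_level: "compact {x. (x, h) \<in> (\<Inter>k. K k)}"
proof -
  have "closed ((\<Inter>k. K k) \<inter> {p. snd p = h})"
    by (intro closed_Int closed_INT ballI closed_K closed_Collect_eq continuous_intros)
  then have "compact ({p \<in> K 0. h \<le> snd p} \<inter> ((\<Inter>k. K k) \<inter> {p. snd p = h}))"
    by (intro compact_Int_closed compact_above)
  then have "compact (fst ` ({p \<in> K 0. h \<le> snd p} \<inter> ((\<Inter>k. K k) \<inter> {p. snd p = h})))"
    by (intro compact_continuous_image continuous_on_fst continuous_on_id)
  moreover have "fst ` ({p \<in> K 0. h \<le> snd p} \<inter> ((\<Inter>k. K k) \<inter> {p. snd p = h})) = {x. (x, h) \<in> (\<Inter>k. K k)}"
    (is "fst ` ?A = ?B")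
  proof (rule antisym; rule subsetI)
    fix x assume "x \<in> ?B"
    then have "(x, h) \<in> ?A" by simp
    then show "x \<in> fst ` ?A" by (rule rev_image_eqI) simp
  qed auto
  ultimately show ?thesis by simp
qed

text \<open>The maximisers of \<open>g\<close> on the top level form a nonempty compact invariant
  set, hence contain an integer point. So integer points can be found at least as far as
  \<open>x\<close> in any direction.\<close>

lemma top_face_int_point:
  assumes top: "\<And>p. p \<in> (\<Inter>k. K k) \<Longrightarrow> snd p \<le> h" and x: "(x, h) \<in> (\<Inter>k. K k)"
  shows "\<exists>v. int_point v \<and> (v, h) \<in> (\<Inter>k. K k) \<and> g \<bullet> x \<le> g \<bullet> v"
proof -
  let ?C = "{x. (x, h) \<in> (\<Inter>k. K k)}"
  have ne: "?C \<noteq> {}" using x by blast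
  obtain \<gamma> where \<gamma>: "\<And>x. x \<in> ?C \<Longrightarrow> g \<bullet> x \<le> \<gamma>" "compact {x \<in> ?C. g \<bullet> x = \<gamma>}"
      "{x \<in> ?C. g \<bullet> x = \<gamma>} \<noteq> {}"
    using compact_argmax_face[OF compact_level ne] by blast
  have "\<exists>v\<in>{x \<in> ?C. g \<bullet> x = \<gamma>}. int_point v"
    using \<gamma> split_fixed_face[OF top_level_split_fixed[OF top] \<gamma>(1)]
    by (intro split_fixed_int_point) auto
  then show ?thesis using \<gamma>(1)[of x] x by auto
qed

text \<open>By compactness the limit has a highest level, at least as high as \<open>p\<close>, and
  this level contains an integer point.\<close>

lemma limit_height:
  assumes int: "\<And>v z. int_point v \<Longrightarrow> (v, z) \<in> K 0 \<Longrightarrow> z \<le> M0" and p: "p \<in> (\<Inter>k. K k)"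
  shows "snd p \<le> M0"
proof -
  let ?S = "{q \<in> K 0. snd p \<le> snd q} \<inter> (\<Inter>k. K k)"
  have "compact ?S" using closed_K by (intro compact_Int_closed compact_above closed_INT) auto
  moreover have "p \<in> ?S" using p by auto
  then have "?S \<noteq> {}" by blast
  ultimately have "\<exists>q\<in>?S. \<forall>r\<in>?S. snd r \<le> snd q"
    by (intro continuous_attains_sup continuous_on_snd continuous_on_id)
  then obtain q where q: "q \<in> ?S" "\<forall>r\<in>?S. snd r \<le> snd q" ..
  have "snd r \<le> snd q" if r: "r \<in> (\<Inter>k. K k)" for r
  proof (cases "snd p \<le> snd r")
    case True
    with r have "r \<in> ?S" by auto
    with q(2) show ?thesis ..
  next
    case False with q(1) show ?thesis by auto
  qed
  moreover have "(fst q, snd q) \<in> (\<Inter>k. K k)" using q(1) by simp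
  ultimately obtain v where "int_point v" "(v, snd q) \<in> (\<Inter>k. K k)"
    using top_face_int_point[of "snd q" "fst q" 0] by auto
  then have "snd q \<le> M0" using int by auto
  then show ?thesis using q(1) by auto
qed

end

subsection \<open>Exact bounds on faces of the integer hull\<close>

text \<open>Serves to scale a supporting functional of a face until it outweighs a second functional
  at the finitely many points off the face.\<close>

lemma finite_positive_scale:
  fixes p q :: "'a \<Rightarrow> real"
  assumes "finite V" and "\<And>v. v \<in> V \<Longrightarrow> 0 < p v"
  shows "\<exists>N>0. \<forall>v\<in>V. q v < N * p v"
  using assms
proof (induction V)
  case empty then show ?case by (auto intro: exI[of _ 1])
next
  case (insert v V)
  then obtain N where N: "0 < N" "\<forall>v\<in>V. q v < N * p v" by auto
  define N' where "N' = max N ((\<bar>q v\<bar> + 1) / p v)"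
  have pv: "0 < p v" using insert.prems by simp
  have "q u < N' * p u" if "u \<in> V" for u
  proof -
    have "N * p u \<le> N' * p u" using insert.prems[of u] that by (simp add: N'_def)
    then show ?thesis using N(2) that by force
  qed
  moreover have "q v < N' * p v"
  proof -
    have "(\<bar>q v\<bar> + 1) / p v * p v \<le> N' * p v" using pv by (intro mult_right_mono) (auto simp: N'_def)
    then show ?thesis using pv by simp
  qed
  moreover have "0 < N'" using N(1) by (simp add: N'_def)
  ultimately show ?case by auto
qed

text \<open>The polytope itself does not appear: only its integer points \<open>V\<close> do, with
  the facts that integer points have height at most \<open>M0\<close>, that those attaining it
  belong to \<open>V\<close>, and that \<open>K 0\<close> falls at least linearly far from the hull
  of \<open>V\<close>.\<close>

locale lattice_free_chain = split_chain K for K :: "nat \<Rightarrow> ((real^'n) \<times> real) set" +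
  fixes V :: "(real^'n) set" and W :: "((real^'n) \<times> real) set" and M0 :: real
  assumes finite_V: "finite V" and finite_W: "finite W"
    and int_W: "\<And>a b. (a, b) \<in> W \<Longrightarrow> int_point a \<and> b \<in> \<int>"
    and cone_W: "\<And>a b. (\<forall>v\<in>V. a \<bullet> v \<le> b) \<longleftrightarrow> (a, b) \<in> convex_cone hull W"
    and int_height: "\<And>v z. int_point v \<Longrightarrow> (v, z) \<in> K 0 \<Longrightarrow> z \<le> M0"
    and int_top: "\<And>v. int_point v \<Longrightarrow> (v, M0) \<in> K 0 \<Longrightarrow> v \<in> V"
    and growth: "\<exists>A>0. \<exists>B>0. \<forall>x z. (x, z) \<in> K 0 \<longrightarrow> z \<le> M0 \<longrightarrow> excess W x \<le> A + B * (M0 - z)"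
begin

abbreviation D :: "real^'n \<Rightarrow> real" where "D \<equiv> excess W"

lemma valid_le_D:
  assumes "\<And>v. v \<in> V \<Longrightarrow> a \<bullet> v \<le> b"
  obtains \<Lambda> where "0 \<le> \<Lambda>" "\<And>x. a \<bullet> x - b \<le> \<Lambda> * D x"
  using cone_le_excess[OF finite_W, of a b] cone_W assms by blast

lemma W_valid: "(a, b) \<in> W \<Longrightarrow> v \<in> V \<Longrightarrow> a \<bullet> v \<le> b"
  using cone_W[of a b] hull_inc[of "(a, b)" W] by blast

lemma limit_le_M0: "p \<in> (\<Inter>k. K k) \<Longrightarrow> snd p \<le> M0"
  by (rule limit_height) (use int_height in blast)+

text \<open>For every \<open>(a, b)\<close> in \<open>W\<close> an integer point of level
  \<open>M0\<close> lies at least as far as \<open>x\<close> in direction \<open>a\<close>. That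
  point is in \<open>V\<close>, so the level satisfies all inequalities of the hull of
  \<open>V\<close>.\<close>

lemma limit_top:
  assumes "(x, z) \<in> (\<Inter>k. K k)" "M0 \<le> z"
  shows "z = M0" "D x \<le> 0"
proof -
  from limit_le_M0[OF assms(1)] assms(2) show z: "z = M0" by simp
  have "a \<bullet> x - b \<le> 0" if ab: "(a, b) \<in> W" for a b
  proof -
    obtain v where "int_point v" "(v, M0) \<in> (\<Inter>k. K k)" "a \<bullet> x \<le> a \<bullet> v"
      using top_face_int_point[OF limit_le_M0, of x a] assms(1) unfolding z by blast
    then show ?thesis using int_top[of v] W_valid[OF ab, of v] by auto
  qed
  then show "D x \<le> 0" using finite_W by (auto simp: excess_le_iff)
qed

section \<open>Approximate bounds from compactness\<close>

lemma height_eventually_le: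
  assumes "0 < \<epsilon>" shows "\<exists>k. \<forall>x z. (x, z) \<in> K k \<longrightarrow> z \<le> M0 + \<epsilon>"
proof -
  have "closed {p::(real^'n) \<times> real. M0 + \<epsilon> \<le> snd p}"
    by (intro closed_Collect_le continuous_intros)
  moreover have "(\<Inter>k. K k) \<inter> {p. M0 + \<epsilon> \<le> snd p} = {}"
    using limit_top(1) assms by fastforce
  ultimately obtain k where "K k \<inter> {p. M0 + \<epsilon> \<le> snd p} = {}"
    using eventually_disjoint[of "{p. M0 + \<epsilon> \<le> snd p}" "M0 + \<epsilon>"] by blast
  then show ?thesis by (force intro!: exI[of _ k])
qed

text \<open>The limit reaches \<open>M0\<close> only where \<open>D\<close> vanishes, so some stage
  has no point with \<open>\<eta> \<le> D x\<close> and height at least \<open>M0\<close>. The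
  maximal height over a compact part of that stage then leaves a positive gap.\<close>

lemma negative_off_hull:
  assumes "0 < \<eta>"
  shows "\<exists>\<nu>>0. \<exists>k. \<forall>x z. (x, z) \<in> K k \<longrightarrow> \<eta> \<le> D x \<longrightarrow> z \<le> M0 - \<nu>"
proof -
  have cD: "closed {p::(real^'n) \<times> real. \<eta> \<le> D (fst p)}"
    using closed_vimage_fst[OF closed_excess_ge[OF finite_W, of \<eta>]] by (simp add: vimage_def)
  have cz: "closed {p::(real^'n) \<times> real. s \<le> snd p}" for s
    by (intro closed_Collect_le continuous_intros)
  let ?E = "{p::(real^'n) \<times> real. M0 \<le> snd p} \<inter> {p. \<eta> \<le> D (fst p)}"
  have "(\<Inter>k. K k) \<inter> ?E = {}"
  proof (rule ccontr)
    assume "(\<Inter>k. K k) \<inter> ?E \<noteq> {}"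
    then obtain x z where "(x, z) \<in> (\<Inter>k. K k)" "M0 \<le> z" "\<eta> \<le> D x" by auto
    with limit_top(2)[of x z] assms show False by simp
  qed
  then obtain k where k: "K k \<inter> ?E = {}"
    using eventually_disjoint[OF closed_Int[OF cz cD], of M0 M0] by auto
  \<comment> \<open>The cut at \<open>M0 - 1\<close> only provides compactness; lower points satisfy
    the claim with gap 1.\<close>
  let ?S = "{p \<in> K 0. M0 - 1 \<le> snd p} \<inter> (K k \<inter> {p. \<eta> \<le> D (fst p)})"
  have S: "compact ?S" by (intro compact_Int_closed compact_above closed_Int closed_K cD)
  have mem: "(x, z) \<in> ?S" if "(x, z) \<in> K k" "\<eta> \<le> D x" "M0 - 1 \<le> z" for x z
    using that K_antimono[of 0 k] by auto
  show ?thesis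
  proof (cases "?S = {}")
    case True
    have "z \<le> M0 - 1" if "(x, z) \<in> K k" "\<eta> \<le> D x" for x z
      using mem[OF that] True by fastforce
    then show ?thesis by (intro exI[of _ 1] conjI exI[of _ k]) auto
  next
    case False
    have "\<exists>q\<in>?S. \<forall>r\<in>?S. snd r \<le> snd q"
      using S False by (intro continuous_attains_sup continuous_on_snd continuous_on_id)
    then obtain q where q: "q \<in> ?S" "\<forall>r\<in>?S. snd r \<le> snd q" ..
    have "snd q < M0"
    proof (rule ccontr)
      assume "\<not> snd q < M0"
      with q(1) have "q \<in> K k \<inter> ?E" by simp
      with k show False by blast
    qed
    moreover have "z \<le> M0 - min 1 (M0 - snd q)" if "(x, z) \<in> K k" "\<eta> \<le> D x" for x z
    proof (cases "M0 - 1 \<le> z")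
      case True
      from q(2) mem[OF that True] have "snd (x, z) \<le> snd q" ..
      then show ?thesis by simp
    qed auto
    ultimately show ?thesis
      by (intro exI[of _ "min 1 (M0 - snd q)"] conjI exI[of _ k]) auto
  qed
qed

text \<open>Where \<open>D\<close> is below \<open>\<delta> / 2\<close>, heights are eventually at
  most \<open>M0 + c * \<delta> / 2\<close>. Elsewhere the gap \<open>\<nu>\<close> absorbs the
  constant \<open>A\<close> of the growth condition, so \<open>D\<close> is at most a fixed multiple
  of \<open>M0 - z\<close>, and a small \<open>c\<close> cancels this multiple.\<close>

lemma uniform_bound:
  assumes "0 < \<delta>"
  shows "\<exists>c0>0. \<forall>c. 0 < c \<and> c \<le> c0 \<longrightarrow> (\<exists>k. \<forall>x z. (x, z) \<in> K k \<longrightarrow> z \<le> M0 + c * (\<delta> - D x))"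
proof -
  obtain A B where AB: "0 < A" "0 < B"
    "\<And>x z. (x, z) \<in> K 0 \<Longrightarrow> z \<le> M0 \<Longrightarrow> D x \<le> A + B * (M0 - z)"
    using growth by blast
  obtain \<nu> k where \<nu>: "0 < \<nu>" "\<And>x z. (x, z) \<in> K k \<Longrightarrow> \<delta> / 2 \<le> D x \<Longrightarrow> z \<le> M0 - \<nu>"
    using negative_off_hull[of "\<delta> / 2"] assms by auto
  have pos: "0 < A / \<nu> + B" using AB \<nu> by (simp add: add_pos_pos)
  show ?thesis
  proof (intro exI[of _ "1 / (A / \<nu> + B)"] conjI allI impI)
    show "0 < 1 / (A / \<nu> + B)" using pos by simp
    fix c assume c: "0 < c \<and> c \<le> 1 / (A / \<nu> + B)"
    then have c1: "c * (A / \<nu> + B) \<le> 1" using pos by (simp add: field_simps)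
    obtain l where l: "\<And>x z. (x, z) \<in> K l \<Longrightarrow> z \<le> M0 + c * \<delta> / 2"
      using height_eventually_le[of "c * \<delta> / 2"] assms c by auto
    have "z \<le> M0 + c * (\<delta> - D x)" if p: "(x, z) \<in> K (max k l)" for x z
    proof (cases "\<delta> / 2 \<le> D x")
      case False
      have "(x, z) \<in> K l" using p K_antimono[of l "max k l"] by auto
      then have "z \<le> M0 + c * (\<delta> / 2)" using l by simp
      also have "c * (\<delta> / 2) \<le> c * (\<delta> - D x)" using False c by (intro mult_left_mono) auto
      finally show ?thesis by simp
    next
      case True
      have pk: "(x, z) \<in> K k" and p0: "(x, z) \<in> K 0"
        using p K_antimono[of k "max k l"] K_antimono[of 0 "max k l"] by auto
      have z: "\<nu> \<le> M0 - z" using \<nu>(2)[OF pk True] by simp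
      have "A * 1 \<le> A * ((M0 - z) / \<nu>)" using z \<nu> AB by (intro mult_left_mono) auto
      then have "D x \<le> (A / \<nu> + B) * (M0 - z)"
        using AB(3)[OF p0] z \<nu>(1) by (simp add: algebra_simps)
      then have "c * D x \<le> c * ((A / \<nu> + B) * (M0 - z))" using c by (intro mult_left_mono) auto
      also have "\<dots> = (c * (A / \<nu> + B)) * (M0 - z)" by simp
      also have "\<dots> \<le> 1 * (M0 - z)" using c1 z \<nu>(1) by (intro mult_right_mono) auto
      finally have "z \<le> M0 - c * D x" by simp
      moreover have "0 < c * \<delta>" using c assms by simp
      ultimately show ?thesis by (simp add: algebra_simps)
    qed
    then show "\<exists>k. \<forall>x z. (x, z) \<in> K k \<longrightarrow> z \<le> M0 + c * (\<delta> - D x)" by blast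
  qed
qed

text \<open>The stage \<open>k\<close> is chosen after \<open>c\<close>, so that the bounds for two faces can be used with a
  common \<open>c\<close>.\<close>

definition face_bound :: "real^'n \<Rightarrow> real \<Rightarrow> bool" where
  "face_bound g \<gamma> \<longleftrightarrow> (\<exists>\<rho>0>0. \<forall>\<rho>. 0 < \<rho> \<and> \<rho> \<le> \<rho>0 \<longrightarrow> (\<exists>c0>0. \<forall>c. 0 < c \<and> c \<le> c0 \<longrightarrow>
     (\<exists>k. \<forall>x z. (x, z) \<in> K k \<longrightarrow> z \<le> M0 + c * (\<rho> * (\<gamma> - g \<bullet> x) - D x))))"

lemma bound_step:
  assumes split: "is_split \<pi> \<pi>0"
    and off: "\<And>x z. (x, z) \<in> K k \<Longrightarrow> \<pi> \<bullet> x \<le> \<pi>0 \<or> \<pi>0 + 1 \<le> \<pi> \<bullet> x \<Longrightarrow>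
      z \<le> M0 + c * (\<rho> * (\<gamma> - g \<bullet> x) - (a \<bullet> x - b))"
    and p: "(x, z) \<in> K (Suc k)"
  shows "z \<le> M0 + c * (\<rho> * (\<gamma> - g \<bullet> x) - (a \<bullet> x - b))"
proof -
  have eq: "M0 + c * (\<rho> * (\<gamma> - g \<bullet> y) - (a \<bullet> y - b)) =
      ((- c * \<rho>) *\<^sub>R g - c *\<^sub>R a) \<bullet> y + (M0 + c * \<rho> * \<gamma> + c * b)" for y
    by (simp add: inner_diff_left inner_minus_left algebra_simps)
  show ?thesis unfolding eq using affine_bound_step[OF split _ p] off unfolding eq by blast
qed

text \<open>\<open>D\<close> is a maximum of affine functions. Replacing it by the one attaining it
  at the given \<open>x\<close> weakens the bound at all other points and loses nothing at
  \<open>x\<close>, so the affine step applies.\<close>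

lemma D_bound_step:
  assumes "is_split \<pi> \<pi>0" and "0 < c"
    and off: "\<And>x z. (x, z) \<in> K k \<Longrightarrow> \<pi> \<bullet> x \<le> \<pi>0 \<or> \<pi>0 + 1 \<le> \<pi> \<bullet> x \<Longrightarrow>
      z \<le> M0 + c * (\<rho> * (\<gamma> - g \<bullet> x) - D x)"
    and p: "(x, z) \<in> K (Suc k)"
  shows "z \<le> M0 + c * (\<rho> * (\<gamma> - g \<bullet> x) - D x)"
proof -
  have mono: "z \<le> M0 + c * (\<rho> * (\<gamma> - g \<bullet> x) - (a \<bullet> x - b))"
    if "z \<le> M0 + c * (\<rho> * (\<gamma> - g \<bullet> x) - D x)" "a \<bullet> x - b \<le> D x" for x z a b
  proof -
    have "c * (\<rho> * (\<gamma> - g \<bullet> x) - D x) \<le> c * (\<rho> * (\<gamma> - g \<bullet> x) - (a \<bullet> x - b))"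
      using that(2) \<open>0 < c\<close> by (intro mult_left_mono) auto
    with that(1) show ?thesis by linarith
  qed
  from finite_W show ?thesis
  proof (cases rule: excess_cases[of W x])
    case 1
    show ?thesis
      using bound_step[OF assms(1) _ p, of c \<rho> \<gamma> g 0 0] mono[OF off, of _ _ 0 0] excess_nonneg[OF finite_W]
      by (simp add: 1)
  next
    case (2 a b)
    show ?thesis
      using bound_step[OF assms(1) _ p, of c \<rho> \<gamma> g a b] mono[OF off, of _ _ a b] excess_ge[OF finite_W 2(1)]
      by (simp add: 2)
  qed
qed

text \<open>The split \<open>(-a, -b)\<close> flattens the slope \<open>\<kappa>\<close> to \<open>c * \<rho>\<close>; once it is small compared with the
  descent away from the hull of \<open>V\<close>, the splits given by \<open>W\<close> are effective exactly.\<close>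

lemma facet_bound:
  assumes ne: "V \<noteq> {}" and a: "int_point a" "b \<in> \<int>" "a \<noteq> 0" and valid: "\<And>v. v \<in> V \<Longrightarrow> a \<bullet> v \<le> b"
    and \<kappa>: "0 < \<kappa>" "\<And>x z. (x, z) \<in> K 0 \<Longrightarrow> z \<le> M0 + \<kappa> * (b - a \<bullet> x)"
  shows "face_bound a b"
  unfolding face_bound_def
proof (rule exI[of _ 1], intro conjI allI impI)
  fix \<rho> :: real assume "0 < \<rho> \<and> \<rho> \<le> 1"
  then have \<rho>: "0 < \<rho>" "\<rho> \<le> 1" by auto
  obtain \<Lambda> where \<Lambda>: "0 \<le> \<Lambda>" "\<And>x. a \<bullet> x - b \<le> \<Lambda> * D x" using valid_le_D[OF valid] by blast
  \<comment> \<open>The uniform bound is used with slope \<open>c * t\<close>, steep enough to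
    outweigh both \<open>\<rho> * (a \<bullet> x - b)\<close> and \<open>D x\<close> where
    \<open>D x \<ge> 1\<close>; the choice \<open>\<rho> / t\<close> for \<open>\<delta>\<close>
    keeps its constant term at \<open>c * \<rho>\<close>.\<close>
  define t where "t = 2 * (\<rho> * \<Lambda> + 1)"
  have t: "2 \<le> t" using \<rho> \<Lambda> by (simp add: t_def)
  then obtain c0 where c0: "0 < c0"
    "\<And>c. 0 < c \<Longrightarrow> c \<le> c0 \<Longrightarrow> \<exists>k. \<forall>x z. (x, z) \<in> K k \<longrightarrow> z \<le> M0 + c * (\<rho> / t - D x)"
    using uniform_bound[of "\<rho> / t"] \<rho> by auto
  show "\<exists>c0>0. \<forall>c. 0 < c \<and> c \<le> c0 \<longrightarrow>
     (\<exists>k. \<forall>x z. (x, z) \<in> K k \<longrightarrow> z \<le> M0 + c * (\<rho> * (b - a \<bullet> x) - D x))"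
  proof (intro exI[of _ "min (c0 / t) (\<kappa> / \<rho>)"] conjI allI impI)
    show "0 < min (c0 / t) (\<kappa> / \<rho>)" using c0 t \<kappa> \<rho> by simp
    fix c assume "0 < c \<and> c \<le> min (c0 / t) (\<kappa> / \<rho>)"
    then have c: "0 < c" "c * t \<le> c0" "c * \<rho> \<le> \<kappa>" using t \<rho> by (auto simp: field_simps)
    obtain k where "\<And>x z. (x, z) \<in> K k \<Longrightarrow> z \<le> M0 + (c * t) * (\<rho> / t - D x)"
      using c0(2)[of "c * t"] c t by auto
    moreover have "(c * t) * (\<rho> / t - D x) = c * \<rho> - c * t * D x" for x
      using t by (simp add: field_simps)
    ultimately have k: "\<And>x z. (x, z) \<in> K k \<Longrightarrow> z \<le> M0 + c * \<rho> - c * t * D x" by (simp add: add_diff_eq)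
    have split: "is_split (- a) (- b)" using a by (auto simp: is_split_def int_point_def)
    \<comment> \<open>First round: beyond the facet the given slope \<open>\<kappa>\<close> is the
      stronger one, and at slack at least 1 the constant \<open>c * \<rho>\<close> suffices.\<close>
    have k1: "z \<le> M0 + c * (\<rho> * (b - a \<bullet> x))" if p: "(x, z) \<in> K (Suc k)" for x z
    proof -
      have "z \<le> M0 + c * (\<rho> * (b - a \<bullet> x) - (0 \<bullet> x - 0))"
      proof (rule bound_step[OF split _ p])
        fix x z assume p: "(x, z) \<in> K k" and "- a \<bullet> x \<le> - b \<or> - b + 1 \<le> - a \<bullet> x"
        then consider "b - a \<bullet> x \<le> 0" | "1 \<le> b - a \<bullet> x" by (auto simp: inner_minus_left)
        then show "z \<le> M0 + c * (\<rho> * (b - a \<bullet> x) - (0 \<bullet> x - 0))"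
        proof cases
          case 1
          have "z \<le> M0 + \<kappa> * (b - a \<bullet> x)" using \<kappa>(2) p K_antimono[of 0 k] by auto
          also have "\<kappa> * (b - a \<bullet> x) \<le> (c * \<rho>) * (b - a \<bullet> x)"
            using 1 c(3) by (intro mult_right_mono_neg)
          finally show ?thesis by simp
        next
          case 2
          have "0 \<le> c * t * D x" using c t excess_nonneg[OF finite_W] by simp
          then have "z \<le> M0 + c * \<rho> * 1" using k[OF p] by simp
          also have "c * \<rho> * 1 \<le> c * \<rho> * (b - a \<bullet> x)"
            using 2 c(1) \<rho> by (intro mult_left_mono) auto
          finally show ?thesis by simp
        qed
      qed
      then show ?thesis by simp
    qed
    \<comment> \<open>Second round: the split given by the member of \<open>W\<close> that attains
      \<open>D x\<close> contributes the term \<open>- D x\<close>.\<close>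
    have "z \<le> M0 + c * (\<rho> * (b - a \<bullet> x) - D x)" if p: "(x, z) \<in> K (Suc (Suc k))" for x z
      using finite_W
    proof (cases rule: excess_cases[of W x])
      case 1
      have "(x, z) \<in> K (Suc k)" using p K_antimono[of "Suc k" "Suc (Suc k)"] by auto
      from k1[OF this] show ?thesis by (simp add: 1)
    next
      case (2 \<pi> \<pi>0)
      have low: "z \<le> M0 + c * (\<rho> * (b - a \<bullet> x) - (\<pi> \<bullet> x - \<pi>0))"
        if p: "(x, z) \<in> K (Suc k)" and "\<pi> \<bullet> x \<le> \<pi>0" for x z
      proof -
        have "0 \<le> c * (\<pi>0 - \<pi> \<bullet> x)" using that c(1) by simp
        with k1[OF p] show ?thesis by (simp add: algebra_simps)
      qed
      have high: "z \<le> M0 + c * (\<rho> * (b - a \<bullet> x) - (\<pi> \<bullet> x - \<pi>0))"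
        if p: "(x, z) \<in> K (Suc k)" and x: "\<pi>0 + 1 \<le> \<pi> \<bullet> x" for x z
      proof -
        have D: "\<pi> \<bullet> x - \<pi>0 \<le> D x" using excess_ge[OF finite_W 2(1)] .
        with x have D1: "1 \<le> D x" by linarith
        have "(x, z) \<in> K k" using p K_antimono[of k "Suc k"] by auto
        then have "z \<le> M0 + c * (\<rho> - t * D x)" using k by (force simp: algebra_simps)
        also have "c * (\<rho> - t * D x) \<le> c * (\<rho> * (b - a \<bullet> x) - (\<pi> \<bullet> x - \<pi>0))"
        proof (intro mult_left_mono)
          have "\<rho> * (a \<bullet> x - b) \<le> \<rho> * (\<Lambda> * D x)" using \<rho> \<Lambda>(2) by (intro mult_left_mono) auto
          moreover have "0 \<le> \<rho> * (\<Lambda> * D x)" using \<rho> \<Lambda>(1) D1 by simp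
          moreover have "t * D x = 2 * (\<rho> * (\<Lambda> * D x)) + 2 * D x" by (simp add: t_def algebra_simps)
          ultimately show "\<rho> - t * D x \<le> \<rho> * (b - a \<bullet> x) - (\<pi> \<bullet> x - \<pi>0)"
            using D D1 \<rho> by (simp add: right_diff_distrib)
        qed (use c in simp)
        finally show ?thesis by simp
      qed
      show ?thesis
      \<comment> \<open>A pair with zero normal is no split, but since it is valid on the nonempty
        \<open>V\<close> its affine function is nowhere positive.\<close>
      proof (cases "\<pi> = 0")
        case True
        obtain v where "v \<in> V" using ne by blast
        then have "\<pi> \<bullet> x \<le> \<pi>0" using W_valid[OF 2(1)] True by force
        moreover have "(x, z) \<in> K (Suc k)" using p K_antimono[of "Suc k" "Suc (Suc k)"] by auto
        ultimately show ?thesis using low 2(2) by metis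
      next
        case False
        then have "is_split \<pi> \<pi>0" using int_W[OF 2(1)] by (simp add: is_split_def)
        from bound_step[OF this _ p, of c \<rho> b a \<pi> \<pi>0] show ?thesis
          unfolding 2(2) using low high by blast
      qed
    qed
    then show "\<exists>k. \<forall>x z. (x, z) \<in> K k \<longrightarrow> z \<le> M0 + c * (\<rho> * (b - a \<bullet> x) - D x)" by blast
  qed
qed simp

text \<open>On the finite set \<open>V\<close> the slack of \<open>a\<close> is at most
  \<open>C\<close> times that of \<open>g\<close>. At other points the error is at most a multiple
  of \<open>D\<close>, which is absorbed by half of the descent when \<open>\<rho>\<close> is
  small.\<close>

lemma face_bound_subface:
  assumes ab: "face_bound a b" and g: "\<And>v. v \<in> V \<Longrightarrow> g \<bullet> v \<le> \<gamma>"
    and sub: "\<And>v. v \<in> V \<Longrightarrow> g \<bullet> v = \<gamma> \<Longrightarrow> b \<le> a \<bullet> v"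
  shows "face_bound g \<gamma>"
proof -
  obtain C where C: "0 < C" "\<forall>v\<in>{v \<in> V. g \<bullet> v < \<gamma>}. b - a \<bullet> v < C * (\<gamma> - g \<bullet> v)"
    using finite_positive_scale[of "{v \<in> V. g \<bullet> v < \<gamma>}" "\<lambda>v. \<gamma> - g \<bullet> v" "\<lambda>v. b - a \<bullet> v"] finite_V
    by auto
  have "(C *\<^sub>R g - a) \<bullet> v \<le> C * \<gamma> - b" if "v \<in> V" for v
  proof (cases "g \<bullet> v = \<gamma>")
    case True then show ?thesis using sub[OF that] by (simp add: inner_diff_left)
  next
    case False
    then have "b - a \<bullet> v < C * (\<gamma> - g \<bullet> v)" using C(2) g[OF that] that by auto
    then show ?thesis by (simp add: inner_diff_left algebra_simps)
  qed
  then obtain \<Lambda> where \<Lambda>: "0 \<le> \<Lambda>" "\<And>x. (C *\<^sub>R g - a) \<bullet> x - (C * \<gamma> - b) \<le> \<Lambda> * D x"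
    using valid_le_D by blast
  have le: "b - a \<bullet> x \<le> C * (\<gamma> - g \<bullet> x) + \<Lambda> * D x" for x
    using \<Lambda>(2)[of x] by (simp add: inner_diff_left algebra_simps)
  obtain \<rho>0 where \<rho>0: "0 < \<rho>0" "\<And>\<rho>. 0 < \<rho> \<Longrightarrow> \<rho> \<le> \<rho>0 \<Longrightarrow> \<exists>c0>0. \<forall>c. 0 < c \<and> c \<le> c0 \<longrightarrow>
     (\<exists>k. \<forall>x z. (x, z) \<in> K k \<longrightarrow> z \<le> M0 + c * (\<rho> * (b - a \<bullet> x) - D x))"
    using ab unfolding face_bound_def by blast
  show ?thesis
    unfolding face_bound_def
  proof (rule exI[of _ "2 * C * min \<rho>0 (1 / (2 * (\<Lambda> + 1)))"], intro conjI allI impI)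
    show "0 < 2 * C * min \<rho>0 (1 / (2 * (\<Lambda> + 1)))" using C \<Lambda> \<rho>0 by simp
    fix \<rho> assume \<rho>: "0 < \<rho> \<and> \<rho> \<le> 2 * C * min \<rho>0 (1 / (2 * (\<Lambda> + 1)))"
    \<comment> \<open>The given bound is applied with \<open>2 * c\<close> and
      \<open>\<sigma>\<close>. Of the resulting descent \<open>2 * c * D x\<close> at most one half
      is spent on the error, because \<open>\<sigma> * \<Lambda> \<le> 1 / 2\<close>.\<close>
    define \<sigma> where "\<sigma> = \<rho> / (2 * C)"
    have "\<sigma> \<le> min \<rho>0 (1 / (2 * (\<Lambda> + 1)))"
      using \<rho> C(1) unfolding \<sigma>_def by (subst pos_divide_le_eq) (auto simp: mult.commute)
    then have \<sigma>: "0 < \<sigma>" "\<sigma> \<le> \<rho>0" "\<sigma> \<le> 1 / (2 * (\<Lambda> + 1))" using \<rho> C by (auto simp: \<sigma>_def)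
    have "\<sigma> * (2 * (\<Lambda> + 1)) \<le> 1" using \<sigma>(3) \<Lambda>(1) by (simp add: field_simps)
    then have \<sigma>\<Lambda>: "\<sigma> * \<Lambda> \<le> 1 / 2" using \<sigma>(1) by (simp add: algebra_simps)
    obtain c0 where c0: "0 < c0" "\<And>c. 0 < c \<Longrightarrow> c \<le> c0 \<Longrightarrow>
       \<exists>k. \<forall>x z. (x, z) \<in> K k \<longrightarrow> z \<le> M0 + c * (\<sigma> * (b - a \<bullet> x) - D x)"
      using \<rho>0(2)[OF \<sigma>(1,2)] by blast
    show "\<exists>c0>0. \<forall>c. 0 < c \<and> c \<le> c0 \<longrightarrow>
       (\<exists>k. \<forall>x z. (x, z) \<in> K k \<longrightarrow> z \<le> M0 + c * (\<rho> * (\<gamma> - g \<bullet> x) - D x))"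
    proof (intro exI[of _ "c0 / 2"] conjI allI impI)
      show "0 < c0 / 2" using c0 by simp
      fix c assume c: "0 < c \<and> c \<le> c0 / 2"
      then obtain k where k: "\<And>x z. (x, z) \<in> K k \<Longrightarrow> z \<le> M0 + (2 * c) * (\<sigma> * (b - a \<bullet> x) - D x)"
        using c0(2)[of "2 * c"] by auto
      have "(2 * c) * (\<sigma> * (b - a \<bullet> x) - D x) \<le> c * (\<rho> * (\<gamma> - g \<bullet> x) - D x)" for x
      proof -
        have "\<sigma> * (b - a \<bullet> x) \<le> \<sigma> * (C * (\<gamma> - g \<bullet> x) + \<Lambda> * D x)"
          using le \<sigma>(1) by (intro mult_left_mono) auto
        also have "\<dots> = (\<sigma> * C) * (\<gamma> - g \<bullet> x) + (\<sigma> * \<Lambda>) * D x" by (simp add: algebra_simps)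
        also have "\<sigma> * C = \<rho> / 2" using C by (simp add: \<sigma>_def)
        also have "(\<sigma> * \<Lambda>) * D x \<le> 1 / 2 * D x"
          using \<sigma>\<Lambda> excess_nonneg[OF finite_W] by (rule mult_right_mono)
        finally have "2 * (\<sigma> * (b - a \<bullet> x) - D x) \<le> \<rho> * (\<gamma> - g \<bullet> x) - D x" by simp
        then have "c * (2 * (\<sigma> * (b - a \<bullet> x) - D x)) \<le> c * (\<rho> * (\<gamma> - g \<bullet> x) - D x)"
          using c by (intro mult_left_mono) auto
        then show ?thesis by (simp only: mult.left_commute mult.assoc)
      qed
      with k show "\<exists>k. \<forall>x z. (x, z) \<in> K k \<longrightarrow> z \<le> M0 + c * (\<rho> * (\<gamma> - g \<bullet> x) - D x)"
        by (meson add_left_mono order_trans)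
    qed
  qed
qed

text \<open>On the side \<open>\<pi> \<bullet> x \<le> \<pi>0\<close> the slack \<open>N * \<gamma> - \<pi>0 - (N *\<^sub>R g - \<pi>) \<bullet> x\<close> is at most
  \<open>N * (\<gamma> - g \<bullet> x)\<close>, and symmetrically on the other side.\<close>

lemma face_bound_split:
  assumes split: "is_split \<pi> \<pi>0" and N: "0 < N"
    and 1: "face_bound (N *\<^sub>R g - \<pi>) (N * \<gamma> - \<pi>0)"
    and 2: "face_bound (N *\<^sub>R g + \<pi>) (N * \<gamma> + (\<pi>0 + 1))"
  shows "face_bound g \<gamma>"
proof -
  obtain \<rho>1 where \<rho>1: "0 < \<rho>1" "\<And>\<rho>. 0 < \<rho> \<Longrightarrow> \<rho> \<le> \<rho>1 \<Longrightarrow> \<exists>c0>0. \<forall>c. 0 < c \<and> c \<le> c0 \<longrightarrow>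
     (\<exists>k. \<forall>x z. (x, z) \<in> K k \<longrightarrow> z \<le> M0 + c * (\<rho> * (N * \<gamma> - \<pi>0 - (N *\<^sub>R g - \<pi>) \<bullet> x) - D x))"
    using 1 unfolding face_bound_def by blast
  obtain \<rho>2 where \<rho>2: "0 < \<rho>2" "\<And>\<rho>. 0 < \<rho> \<Longrightarrow> \<rho> \<le> \<rho>2 \<Longrightarrow> \<exists>c0>0. \<forall>c. 0 < c \<and> c \<le> c0 \<longrightarrow>
     (\<exists>k. \<forall>x z. (x, z) \<in> K k \<longrightarrow> z \<le> M0 + c * (\<rho> * (N * \<gamma> + (\<pi>0 + 1) - (N *\<^sub>R g + \<pi>) \<bullet> x) - D x))"
    using 2 unfolding face_bound_def by blast
  show ?thesis
    unfolding face_bound_def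
  proof (rule exI[of _ "N * min \<rho>1 \<rho>2"], intro conjI allI impI)
    show "0 < N * min \<rho>1 \<rho>2" using N \<rho>1 \<rho>2 by simp
    fix \<rho> assume \<rho>: "0 < \<rho> \<and> \<rho> \<le> N * min \<rho>1 \<rho>2"
    define \<sigma> where "\<sigma> = \<rho> / N"
    have "\<sigma> \<le> min \<rho>1 \<rho>2"
      using \<rho> N unfolding \<sigma>_def by (subst pos_divide_le_eq) (auto simp: mult.commute)
    then have \<sigma>: "0 < \<sigma>" "\<sigma> \<le> \<rho>1" "\<sigma> \<le> \<rho>2" and \<rho>_eq: "\<rho> = \<sigma> * N" using \<rho> N by (auto simp: \<sigma>_def)
    obtain c1 where c1: "0 < c1" "\<And>c. 0 < c \<Longrightarrow> c \<le> c1 \<Longrightarrow> \<exists>k. \<forall>x z. (x, z) \<in> K k \<longrightarrow>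
        z \<le> M0 + c * (\<sigma> * (N * \<gamma> - \<pi>0 - (N *\<^sub>R g - \<pi>) \<bullet> x) - D x)"
      using \<rho>1(2)[OF \<sigma>(1,2)] by blast
    obtain c2 where c2: "0 < c2" "\<And>c. 0 < c \<Longrightarrow> c \<le> c2 \<Longrightarrow> \<exists>k. \<forall>x z. (x, z) \<in> K k \<longrightarrow>
        z \<le> M0 + c * (\<sigma> * (N * \<gamma> + (\<pi>0 + 1) - (N *\<^sub>R g + \<pi>) \<bullet> x) - D x)"
      using \<rho>2(2)[OF \<sigma>(1,3)] by blast
    show "\<exists>c0>0. \<forall>c. 0 < c \<and> c \<le> c0 \<longrightarrow>
       (\<exists>k. \<forall>x z. (x, z) \<in> K k \<longrightarrow> z \<le> M0 + c * (\<rho> * (\<gamma> - g \<bullet> x) - D x))"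
    proof (intro exI[of _ "min c1 c2"] conjI allI impI)
      show "0 < min c1 c2" using c1 c2 by simp
      fix c assume c: "0 < c \<and> c \<le> min c1 c2"
      obtain k1 where k1: "\<And>x z. (x, z) \<in> K k1 \<Longrightarrow>
          z \<le> M0 + c * (\<sigma> * (N * \<gamma> - \<pi>0 - (N *\<^sub>R g - \<pi>) \<bullet> x) - D x)"
        using c1(2)[of c] c by auto
      obtain k2 where k2: "\<And>x z. (x, z) \<in> K k2 \<Longrightarrow>
          z \<le> M0 + c * (\<sigma> * (N * \<gamma> + (\<pi>0 + 1) - (N *\<^sub>R g + \<pi>) \<bullet> x) - D x)"
        using c2(2)[of c] c by auto
      \<comment> \<open>Outside the split, each side gets the bound from one of the two smaller
        faces; one more round with the split itself extends it to the points in between.\<close>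
      have "z \<le> M0 + c * (\<rho> * (\<gamma> - g \<bullet> x) - D x)"
        if p: "(x, z) \<in> K (max k1 k2)" and off: "\<pi> \<bullet> x \<le> \<pi>0 \<or> \<pi>0 + 1 \<le> \<pi> \<bullet> x" for x z
        using off
      proof
        assume "\<pi> \<bullet> x \<le> \<pi>0"
        then have "\<sigma> * (N * \<gamma> - \<pi>0 - (N *\<^sub>R g - \<pi>) \<bullet> x) \<le> \<sigma> * (N * (\<gamma> - g \<bullet> x))"
          using \<sigma>(1) by (intro mult_left_mono) (auto simp: inner_diff_left algebra_simps)
        then have "c * (\<sigma> * (N * \<gamma> - \<pi>0 - (N *\<^sub>R g - \<pi>) \<bullet> x) - D x) \<le> c * (\<rho> * (\<gamma> - g \<bullet> x) - D x)"
          using c by (intro mult_left_mono) (auto simp: \<rho>_eq mult.assoc)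
        moreover have "(x, z) \<in> K k1" using p K_antimono[of k1 "max k1 k2"] by auto
        ultimately show ?thesis using k1 by (meson add_left_mono order_trans)
      next
        assume "\<pi>0 + 1 \<le> \<pi> \<bullet> x"
        then have "\<sigma> * (N * \<gamma> + (\<pi>0 + 1) - (N *\<^sub>R g + \<pi>) \<bullet> x) \<le> \<sigma> * (N * (\<gamma> - g \<bullet> x))"
          using \<sigma>(1) by (intro mult_left_mono) (auto simp: inner_add_left algebra_simps)
        then have "c * (\<sigma> * (N * \<gamma> + (\<pi>0 + 1) - (N *\<^sub>R g + \<pi>) \<bullet> x) - D x) \<le> c * (\<rho> * (\<gamma> - g \<bullet> x) - D x)"
          using c by (intro mult_left_mono) (auto simp: \<rho>_eq mult.assoc)
        moreover have "(x, z) \<in> K k2" using p K_antimono[of k2 "max k1 k2"] by auto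
        ultimately show ?thesis using k2 by (meson add_left_mono order_trans)
      qed
      then show "\<exists>k. \<forall>x z. (x, z) \<in> K k \<longrightarrow> z \<le> M0 + c * (\<rho> * (\<gamma> - g \<bullet> x) - D x)"
        using D_bound_step[OF split] c by blast
    qed
  qed
qed

text \<open>Induction on the number of points of \<open>V\<close> on the face. The parts
  \<open>S1\<close> and \<open>S2\<close> are again exposed: \<open>N *\<^sub>R g\<close>, tilted by
  \<open>\<pi>\<close> in either direction, attains its maximum over \<open>V\<close> exactly on one
  of them when \<open>N\<close> is large.\<close>

lemma face_bound_induct:
  assumes face: "\<And>g \<gamma>. (\<forall>v\<in>V. g \<bullet> v \<le> \<gamma>) \<Longrightarrow> {v \<in> V. g \<bullet> v = \<gamma>} \<noteq> {} \<Longrightarrow>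
      (\<exists>a b. face_bound a b \<and> (\<forall>v\<in>V. g \<bullet> v = \<gamma> \<longrightarrow> b \<le> a \<bullet> v)) \<or>
      (\<exists>\<pi> \<pi>0 S1 S2. is_split \<pi> \<pi>0 \<and> S1 \<noteq> {} \<and> S2 \<noteq> {} \<and> S1 \<union> S2 = {v \<in> V. g \<bullet> v = \<gamma>} \<and>
        (\<forall>x\<in>S1. \<pi> \<bullet> x = \<pi>0) \<and> (\<forall>x\<in>S2. \<pi> \<bullet> x = \<pi>0 + 1))"
    and g: "\<forall>v\<in>V. g \<bullet> v \<le> \<gamma>" and ne: "{v \<in> V. g \<bullet> v = \<gamma>} \<noteq> {}"
  shows "face_bound g \<gamma>"
  using g ne
proof (induction "card {v \<in> V. g \<bullet> v = \<gamma>}" arbitrary: g \<gamma> rule: less_induct)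
  case less
  from face[OF less.prems] show ?case
  proof (elim disjE exE conjE)
    fix a b assume "face_bound a b" "\<forall>v\<in>V. g \<bullet> v = \<gamma> \<longrightarrow> b \<le> a \<bullet> v"
    then show ?thesis using face_bound_subface[of a b g \<gamma>] less.prems(1) by blast
  next
    fix \<pi> \<pi>0 S1 S2
    assume split: "is_split \<pi> \<pi>0" and ne: "S1 \<noteq> {}" "S2 \<noteq> {}" and Un: "S1 \<union> S2 = {v \<in> V. g \<bullet> v = \<gamma>}"
      and S1: "\<forall>x\<in>S1. \<pi> \<bullet> x = \<pi>0" and S2: "\<forall>x\<in>S2. \<pi> \<bullet> x = \<pi>0 + 1"
    \<comment> \<open>The quantity \<open>\<bar>\<pi>0 - \<pi> \<bullet> v\<bar> + 1\<close>
      dominates both \<open>\<pi>0 - \<pi> \<bullet> v\<close> and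
      \<open>\<pi> \<bullet> v - (\<pi>0 + 1)\<close>, so one \<open>N\<close> serves both
      tilts.\<close>
    obtain N where N: "0 < N"
      "\<And>v. v \<in> V \<Longrightarrow> g \<bullet> v < \<gamma> \<Longrightarrow> \<bar>\<pi>0 - \<pi> \<bullet> v\<bar> + 1 < N * (\<gamma> - g \<bullet> v)"
      using finite_positive_scale[of "{v \<in> V. g \<bullet> v < \<gamma>}" "\<lambda>v. \<gamma> - g \<bullet> v" "\<lambda>v. \<bar>\<pi>0 - \<pi> \<bullet> v\<bar> + 1"]
        finite_V by auto
    have in1: "(N *\<^sub>R g - \<pi>) \<bullet> v = N * \<gamma> - N * (\<gamma> - g \<bullet> v) - \<pi> \<bullet> v"
      and in2: "(N *\<^sub>R g + \<pi>) \<bullet> v = N * \<gamma> - N * (\<gamma> - g \<bullet> v) + \<pi> \<bullet> v" for v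
      by (simp_all add: inner_diff_left inner_add_left algebra_simps)
    have off: "(N *\<^sub>R g - \<pi>) \<bullet> v < N * \<gamma> - \<pi>0" "(N *\<^sub>R g + \<pi>) \<bullet> v < N * \<gamma> + (\<pi>0 + 1)"
      if "v \<in> V" "v \<notin> S1 \<union> S2" for v
    proof -
      have "g \<bullet> v < \<gamma>" using that less.prems(1) Un by force
      from N(2)[OF that(1) this] show "(N *\<^sub>R g - \<pi>) \<bullet> v < N * \<gamma> - \<pi>0"
        "(N *\<^sub>R g + \<pi>) \<bullet> v < N * \<gamma> + (\<pi>0 + 1)"
        unfolding in1 in2 by linarith+
    qed
    have on: "g \<bullet> v = \<gamma>" "v \<in> V" if "v \<in> S1 \<union> S2" for v using that Un by auto
    have v1: "(N *\<^sub>R g - \<pi>) \<bullet> v = N * \<gamma> - \<pi>0" "(N *\<^sub>R g + \<pi>) \<bullet> v < N * \<gamma> + (\<pi>0 + 1)" if "v \<in> S1" for v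
      unfolding in1 in2 using on[of v] S1 that by auto
    have v2: "(N *\<^sub>R g - \<pi>) \<bullet> v < N * \<gamma> - \<pi>0" "(N *\<^sub>R g + \<pi>) \<bullet> v = N * \<gamma> + (\<pi>0 + 1)" if "v \<in> S2" for v
      unfolding in1 in2 using on[of v] S2 that by auto
    have F1: "{v \<in> V. (N *\<^sub>R g - \<pi>) \<bullet> v = N * \<gamma> - \<pi>0} = S1"
      using off(1) v1(1) v2(1) on(2) by fastforce
    have F2: "{v \<in> V. (N *\<^sub>R g + \<pi>) \<bullet> v = N * \<gamma> + (\<pi>0 + 1)} = S2"
      using off(2) v1(2) v2(2) on(2) by fastforce
    have fin: "finite (S1 \<union> S2)" using Un finite_V by simp
    have dis: "S1 \<inter> S2 = {}" using S1 S2 by force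
    have "card S1 < card (S1 \<union> S2)" using ne dis fin by (intro psubset_card_mono) auto
    moreover have "\<forall>v\<in>V. (N *\<^sub>R g - \<pi>) \<bullet> v \<le> N * \<gamma> - \<pi>0"
      using off(1) v1(1) v2(1) by (metis UnE order.order_iff_strict)
    ultimately have 1: "face_bound (N *\<^sub>R g - \<pi>) (N * \<gamma> - \<pi>0)"
      using ne(1) less.hyps[of "N *\<^sub>R g - \<pi>" "N * \<gamma> - \<pi>0"] unfolding F1 Un by blast
    have "card S2 < card (S1 \<union> S2)" using ne dis fin by (intro psubset_card_mono) auto
    moreover have "\<forall>v\<in>V. (N *\<^sub>R g + \<pi>) \<bullet> v \<le> N * \<gamma> + (\<pi>0 + 1)"
      using off(2) v1(2) v2(2) by (metis UnE order.order_iff_strict)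
    ultimately have 2: "face_bound (N *\<^sub>R g + \<pi>) (N * \<gamma> + (\<pi>0 + 1))"
      using ne(2) less.hyps[of "N *\<^sub>R g + \<pi>" "N * \<gamma> + (\<pi>0 + 1)"] unfolding F2 Un by blast
    show ?thesis by (rule face_bound_split[OF split N(1) 1 2])
  qed
qed

lemma face_bound_whole:
  assumes "face_bound 0 0" shows "\<exists>k. \<forall>x z. (x, z) \<in> K k \<longrightarrow> z \<le> M0"
proof -
  obtain \<rho> c k where c: "0 < c"
    and k: "\<And>x z. (x, z) \<in> K k \<Longrightarrow> z \<le> M0 + c * (\<rho> * (0 - 0 \<bullet> x) - D x)"
    using assms unfolding face_bound_def by (meson order_refl)
  have "z \<le> M0" if "(x, z) \<in> K k" for x z
  proof -
    have "0 \<le> c * D x" using c excess_nonneg[OF finite_W] by simp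
    with k[OF that] show ?thesis by simp
  qed
  then show ?thesis by blast
qed

text \<open>The face induction needs a nonempty \<open>V\<close>. Without integer points the limit
  cannot reach \<open>M0\<close>, and compactness transfers this to a finite stage.\<close>

lemma no_int_points:
  assumes "V = {}" shows "\<exists>k. \<forall>x z. (x, z) \<in> K k \<longrightarrow> z \<le> M0"
proof -
  have "(\<Inter>k. K k) \<inter> {p. M0 \<le> snd p} = {}"
  proof (rule ccontr)
    assume "(\<Inter>k. K k) \<inter> {p. M0 \<le> snd p} \<noteq> {}"
    then obtain x z where "(x, z) \<in> (\<Inter>k. K k)" "M0 \<le> z" by auto
    then have "(x, M0) \<in> (\<Inter>k. K k)" using limit_top(1)[of x z] by simp
    then obtain v where "int_point v" "(v, M0) \<in> (\<Inter>k. K k)"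
      using top_face_int_point[OF limit_le_M0, of x 0] by blast
    then show False using int_top[of v] assms by auto
  qed
  moreover have "closed {p::(real^'n) \<times> real. M0 \<le> snd p}"
    by (intro closed_Collect_le continuous_intros)
  ultimately obtain k where "K k \<inter> {p. M0 \<le> snd p} = {}"
    using eventually_disjoint[of "{p. M0 \<le> snd p}" M0] by blast
  then show ?thesis by (force intro!: exI[of _ k])
qed

end

subsection \<open>Polyhedra below the region over a lattice-free polytope\<close>

text \<open>Polyhedrality matters here: \<open>Q\<close> above height \<open>M0\<close> is a polytope, so finitely many vertices
  determine \<open>\<kappa>\<close>.\<close>

lemma polyhedron_slope_bound:
  fixes Q :: "((real^'n) \<times> real) set"
  assumes Q: "polyhedron Q" and bdd: "bounded {p \<in> Q. M0 \<le> snd p}"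
    and le: "\<And>x z. (x, z) \<in> Q \<Longrightarrow> M0 \<le> z \<Longrightarrow> a \<bullet> x \<le> b"
    and less: "\<And>x z. (x, z) \<in> Q \<Longrightarrow> M0 < z \<Longrightarrow> a \<bullet> x < b"
    and ex: "\<exists>p\<in>Q. M0 < snd p"
  shows "\<exists>\<kappa>>0. \<forall>x z. (x, z) \<in> Q \<longrightarrow> z \<le> M0 + \<kappa> * (b - a \<bullet> x)"
proof -
  have eq: "{p \<in> Q. M0 \<le> snd p} = Q \<inter> {p. (0, 1) \<bullet> p \<ge> M0}" by (auto simp: inner_prod_def)
  have "polyhedron (Q \<inter> {p. (0, 1) \<bullet> p \<ge> M0})" by (intro polyhedron_Int Q polyhedron_halfspace_ge)
  then have "polytope {p \<in> Q. M0 \<le> snd p}" using bdd by (simp add: eq polytope_eq_bounded_polyhedron)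
  then obtain E where E: "finite E" "{p \<in> Q. M0 \<le> snd p} = convex hull E" unfolding polytope_def by blast
  have EQ: "e \<in> Q" "M0 \<le> snd e" if "e \<in> E" for e using hull_inc[OF that] E(2) by blast+
  define E' where "E' = {e \<in> E. M0 < snd e}"
  \<comment> \<open>The slope for which the desired bound is tight at \<open>e\<close>; the steepest
    vertex above \<open>M0\<close> determines \<open>\<kappa>\<close>.\<close>
  define r where "r e = (snd e - M0) / (b - a \<bullet> fst e)" for e
  have "E' \<noteq> {}"
  proof
    assume "E' = {}"
    then have "E \<subseteq> {p. (0, 1) \<bullet> p \<le> M0}" by (force simp: E'_def inner_prod_def)
    then have "convex hull E \<subseteq> {p. (0, 1) \<bullet> p \<le> M0}" by (intro hull_minimal convex_halfspace_le)
    moreover obtain p where "p \<in> Q" "M0 < snd p" using ex by blast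
    moreover from this have "p \<in> convex hull E" by (simp flip: E(2))
    ultimately show False by (auto simp: inner_prod_def)
  qed
  moreover have "finite E'" using E by (simp add: E'_def)
  ultimately have "Max (r ` E') \<in> r ` E'" and max: "\<And>e. e \<in> E' \<Longrightarrow> r e \<le> Max (r ` E')" by auto
  then obtain e where e: "e \<in> E'" "Max (r ` E') = r e" by auto
  have pos: "0 < b - a \<bullet> fst e" if "e \<in> E'" for e
    using less[of "fst e" "snd e"] EQ(1)[of e] that by (auto simp: E'_def)
  have re: "0 < r e" using pos[OF e(1)] e(1) by (simp add: r_def E'_def)
  have "E \<subseteq> {p. (r e *\<^sub>R a, 1) \<bullet> p \<le> M0 + r e * b}"
  proof
    fix f assume f: "f \<in> E"
    have "snd f - M0 \<le> r e * (b - a \<bullet> fst f)"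
    proof (cases "f \<in> E'")
      case True
      then show ?thesis using max[OF True] pos[OF True] unfolding e(2) by (simp add: r_def[of f] field_simps)
    next
      case False
      then have "snd f = M0" using EQ(2)[OF f] f by (simp add: E'_def)
      moreover have "a \<bullet> fst f \<le> b" using le[of "fst f" "snd f"] EQ[OF f] by simp
      ultimately show ?thesis using re by simp
    qed
    then show "f \<in> {p. (r e *\<^sub>R a, 1) \<bullet> p \<le> M0 + r e * b}" by (simp add: inner_prod_def algebra_simps)
  qed
  then have "convex hull E \<subseteq> {p. (r e *\<^sub>R a, 1) \<bullet> p \<le> M0 + r e * b}"
    by (intro hull_minimal convex_halfspace_le)
  then have high: "z \<le> M0 + r e * (b - a \<bullet> x)" if "(x, z) \<in> Q" "M0 \<le> z" for x z
    using that E(2) by (force simp: inner_prod_def algebra_simps)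
  have "z \<le> M0 + r e * (b - a \<bullet> x)" if q: "(x, z) \<in> Q" "z < M0" for x z
  proof (cases "a \<bullet> x \<le> b")
    case True
    then have "0 \<le> r e * (b - a \<bullet> x)" using re by simp
    then show ?thesis using q(2) by linarith
  next
    case False
    \<comment> \<open>The segment from the point to the steepest vertex \<open>e\<close> meets the
      hyperplane \<open>a \<bullet> x = b\<close>. There its height is at most \<open>M0\<close> by
      \<open>less\<close>, and this is the claimed bound after extrapolation.\<close>
    define s t where "s = b - a \<bullet> fst e" and "t = a \<bullet> x - b"
    have st: "0 < s" "0 < t" using pos[OF e(1)] False by (auto simp: s_def t_def)
    define u where "u = t / (s + t)"
    have u: "0 \<le> u" "u \<le> 1" "(1 - u) = s / (s + t)" using st by (auto simp: u_def field_simps)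
    have "(1 - u) *\<^sub>R (x, z) + u *\<^sub>R e \<in> Q"
      using q EQ(1)[of e] e(1) u polyhedron_imp_convex[OF Q] by (intro convexD) (auto simp: E'_def)
    moreover have "(1 - u) *\<^sub>R (x, z) + u *\<^sub>R e = ((1 - u) *\<^sub>R x + u *\<^sub>R fst e, (1 - u) * z + u * snd e)"
      by (simp add: prod_eq_iff)
    moreover have "a \<bullet> ((1 - u) *\<^sub>R x + u *\<^sub>R fst e) = b"
    proof -
      have "a \<bullet> ((1 - u) *\<^sub>R x + u *\<^sub>R fst e) = b + ((1 - u) * t - u * s)"
        by (simp add: inner_add_right s_def t_def algebra_simps)
      also have "(1 - u) * t - u * s = 0" unfolding u(3) unfolding u_def by simp
      finally show ?thesis by simp
    qed
    ultimately have "(1 - u) * z + u * snd e \<le> M0" using less by (metis linorder_not_le order_less_irrefl)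
    then have "(s + t) * ((1 - u) * z + u * snd e) \<le> (s + t) * M0" using st by simp
    moreover have "(s + t) * (1 - u) = s" "(s + t) * u = t" unfolding u(3) using st by (auto simp: u_def)
    then have "(s + t) * ((1 - u) * z + u * snd e) = s * z + t * snd e"
      by (metis (no_types, opaque_lifting) distrib_left mult.assoc)
    ultimately have "s * z \<le> s * M0 - t * (snd e - M0)" by (simp add: algebra_simps)
    then have "z \<le> (s * M0 - t * (snd e - M0)) / s" using st(1) by (simp add: pos_le_divide_eq mult.commute)
    also have "\<dots> = M0 + r e * (b - a \<bullet> x)"
      using st(1) by (simp add: r_def flip: s_def) (simp add: t_def field_simps)
    finally show ?thesis .
  qed
  with high re show ?thesis by (metis linorder_not_le)
qed

section \<open>Integer points, closed split closures, and boundary hyperplanes of a polytope\<close>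

lemma finite_int_points_bounded:
  fixes S :: "(real^'n) set"
  assumes "bounded S" shows "finite {x \<in> S. int_point x}"
proof -
  obtain B where B: "\<And>x. x \<in> S \<Longrightarrow> norm x \<le> B" using assms by (auto simp: bounded_iff)
  let ?f = "\<lambda>x::real^'n. \<lambda>i. \<lfloor>x $ i\<rfloor>"
  have "?f ` {x \<in> S. int_point x} \<subseteq> (\<Pi>\<^sub>E i\<in>UNIV. {\<lfloor>- B\<rfloor>..\<lfloor>B\<rfloor>})"
  proof -
    have "\<lfloor>- B\<rfloor> \<le> \<lfloor>x $ i\<rfloor>" "\<lfloor>x $ i\<rfloor> \<le> \<lfloor>B\<rfloor>" if "x \<in> S" for x i
    proof -
      have "\<bar>x $ i\<bar> \<le> B" using B[OF that] component_le_norm_cart[of x i] by linarith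
      then show "\<lfloor>- B\<rfloor> \<le> \<lfloor>x $ i\<rfloor>" "\<lfloor>x $ i\<rfloor> \<le> \<lfloor>B\<rfloor>" by (auto intro!: floor_mono)
    qed
    then show ?thesis by (auto simp: PiE_def)
  qed
  then have "finite (?f ` {x \<in> S. int_point x})" by (rule finite_subset) (auto intro: finite_PiE)
  moreover have "inj_on ?f {x \<in> S. int_point x}"
  proof (rule inj_onI)
    fix x y assume "x \<in> {x \<in> S. int_point x}" "y \<in> {x \<in> S. int_point x}" and f: "?f x = ?f y"
    then have "x $ i = of_int \<lfloor>x $ i\<rfloor>" "y $ i = of_int \<lfloor>y $ i\<rfloor>" for i
      by (simp_all add: int_point_def)
    moreover have "\<lfloor>x $ i\<rfloor> = \<lfloor>y $ i\<rfloor>" for i using fun_cong[OF f, of i] .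
    ultimately show "x = y" by (metis vec_eq_iff)
  qed
  ultimately show ?thesis by (rule finite_imageD)
qed

lemma height_le_iff: "height K \<le> ereal M0 \<longleftrightarrow> (\<forall>x z. (x, z) \<in> K \<longrightarrow> z \<le> M0)"
  by (force simp: height_def height_at_def SUP_le_iff Sup_le_iff)

lemma split_chain_rank:
  defines "K \<equiv> \<lambda>k Q. ((\<lambda>S. closure (split_closure S)) ^^ k) Q"
  shows "split_closure_rank k Q \<subseteq> K k Q"
proof (induction k)
  case 0 then show ?case by (simp add: K_def split_closure_rank_def)
next
  case (Suc k)
  have "split_closure_rank (Suc k) Q = split_closure (split_closure_rank k Q)"
    by (simp add: split_closure_rank_def)
  also have "\<dots> \<subseteq> split_closure (K k Q)" by (rule split_closure_mono[OF Suc])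
  also have "\<dots> \<subseteq> K (Suc k) Q" by (simp add: K_def closure_subset)
  finally show ?case .
qed

lemma split_chain_closed_closures:
  assumes "closed Q" "convex Q" and "\<And>s. compact {p \<in> Q. s \<le> snd p}"
  shows "split_chain (\<lambda>k. ((\<lambda>S. closure (split_closure S)) ^^ k) Q)"
proof
  show "closed (((\<lambda>S. closure (split_closure S)) ^^ k) Q)" for k
    using assms(1) by (cases k) auto
  show "convex (((\<lambda>S. closure (split_closure S)) ^^ k) Q)" for k
    using assms(2) by (cases k) (auto intro: convex_closure convex_split_closure)
  show "((\<lambda>S. closure (split_closure S)) ^^ Suc k) Q \<subseteq>
      closure (split_hull (((\<lambda>S. closure (split_closure S)) ^^ k) Q) \<pi> \<pi>0)"
    if "is_split \<pi> \<pi>0" for \<pi> \<pi>0 k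
    using that unfolding funpow.simps o_apply
    by (intro closure_mono) (auto simp: split_closure_def)
  show "compact {p \<in> ((\<lambda>S. closure (split_closure S)) ^^ 0) Q. s \<le> snd p}" for s
    using assms(3) by simp
qed

text \<open>Comparison with a nearest point of \<open>L\<close> bounds each affine function by its
  size on \<open>L\<close> plus a multiple of the distance. \<open>W\<close> need not describe
  \<open>L\<close>: it is applied with \<open>W\<close> for the integer hull, to translate the shape
  of \<open>R_region\<close> into \<open>growth\<close>.\<close>

lemma excess_linear_growth:
  assumes "finite W" and "\<And>y. y \<in> L \<Longrightarrow> norm y \<le> R" and "closed L" "L \<noteq> {}"
  shows "\<exists>A>0. \<exists>B>0. \<forall>x. excess W x \<le> A + B * infdist x L"
proof -
  have R: "0 \<le> R" using assms(2,4) norm_ge_zero order_trans by blast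
  define A where "A = 1 + (\<Sum>(a, b)\<in>W. norm a * R + \<bar>b\<bar>)"
  define B where "B = 1 + (\<Sum>(a, b)\<in>W. norm a)"
  have AB: "1 \<le> A" "1 \<le> B" using R by (auto simp: A_def B_def intro!: sum_nonneg)
  have "excess W x \<le> A + B * infdist x L" for x
    unfolding excess_le_iff[OF assms(1)]
  proof safe
    show "0 \<le> A + B * infdist x L" using AB infdist_nonneg[of x L] by simp
    fix a b assume ab: "(a, b) \<in> W"
    obtain y where y: "y \<in> L" "infdist x L = dist x y" using infdist_attains_inf[OF assms(3,4)] by blast
    have "norm x \<le> R + dist x y" using assms(2)[OF y(1)] norm_triangle_sub[of x y] by (simp add: dist_norm)
    then have "norm a * norm x \<le> norm a * (R + dist x y)" by (simp add: mult_left_mono)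
    moreover have "a \<bullet> x \<le> norm a * norm x" using norm_cauchy_schwarz by blast
    ultimately have "a \<bullet> x - b \<le> (norm a * R + \<bar>b\<bar>) + norm a * dist x y"
      by (simp add: distrib_left)
    moreover have "norm a * R + \<bar>b\<bar> \<le> A"
      using member_le_sum[OF ab, of "\<lambda>(a, b). norm a * R + \<bar>b\<bar>"] assms(1) R by (auto simp: A_def)
    moreover have "norm a \<le> B"
      using member_le_sum[OF ab, of "\<lambda>(a, b). norm a"] assms(1) by (auto simp: B_def)
    then have "norm a * dist x y \<le> B * infdist x L" unfolding y(2) by (intro mult_right_mono) auto
    ultimately show "a \<bullet> x - b \<le> A + B * infdist x L" by linarith
  qed
  with AB show ?thesis by (intro exI[of _ A] conjI exI[of _ B]) auto
qed

text \<open>If no inequality with nonzero normal were tight at \<open>x\<close>, all of these would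
  hold strictly on an open neighbourhood inside \<open>L\<close>; those with zero normal hold
  everywhere once they hold at \<open>x\<close>.\<close>

lemma polytope_boundary_hyperplane:
  assumes "finite W" and L: "\<And>x. x \<in> L \<longleftrightarrow> excess W x \<le> 0" and x: "x \<in> L" "x \<notin> interior L"
  shows "\<exists>a b. (a, b) \<in> W \<and> a \<noteq> 0 \<and> a \<bullet> x = b"
proof (rule ccontr)
  assume *: "\<nexists>a b. (a, b) \<in> W \<and> a \<noteq> 0 \<and> a \<bullet> x = b"
  have le: "a \<bullet> y \<le> b" if "y \<in> L" "(a, b) \<in> W" for a b y
    using that L[of y] excess_le_iff[OF assms(1), of y 0] by auto
  let ?U = "\<Inter>(a, b)\<in>{w \<in> W. fst w \<noteq> 0}. {y. a \<bullet> y < b}"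
  have "open ?U" using assms(1) by (intro open_INT) (auto intro: open_halfspace_lt)
  moreover have "x \<in> ?U" using * le[OF x(1)] by (force simp: order.order_iff_strict)
  moreover have "?U \<subseteq> L"
  proof
    fix y assume y: "y \<in> ?U"
    have "a \<bullet> y - b \<le> 0" if "(a, b) \<in> W" for a b
      using y that le[OF x(1) that] by (cases "a = 0") force+
    then show "y \<in> L" using L excess_le_iff[OF assms(1), of y 0] by auto
  qed
  ultimately show False using x(2) interiorI by blast
qed

text \<open>A relative interior point of the facet lies on the boundary of \<open>L\<close>, hence
  on a hyperplane from \<open>W\<close>. The face cut out by it meets the relative interior of
  \<open>G\<close> and so contains \<open>G\<close>.\<close>

lemma facet_subset_hyperplane:
  assumes "finite W" and L: "\<And>x. x \<in> L \<longleftrightarrow> excess W x \<le> 0" and "convex L" and G: "G facet_of L"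
  shows "\<exists>a b. (a, b) \<in> W \<and> a \<noteq> 0 \<and> (\<forall>x\<in>G. a \<bullet> x = b)"
proof -
  have GL: "G face_of L" "G \<subseteq> L" "G \<noteq> {}" "G \<noteq> L"
    using G facet_of_imp_subset by (auto simp: facet_of_def)
  then have "convex G" using face_of_imp_convex by blast
  then obtain x where x: "x \<in> rel_interior G" using GL(3) rel_interior_eq_empty by blast
  then have "x \<in> G" using rel_interior_subset by blast
  then have xL: "x \<in> L" "x \<notin> interior L"
    using GL face_of_disjoint_interior[OF GL(1,4)] by auto
  obtain a b where ab: "(a, b) \<in> W" "a \<noteq> 0" "a \<bullet> x = b"
    using polytope_boundary_hyperplane[OF assms(1) L xL] by blast
  have face: "L \<inter> {y. a \<bullet> y = b} face_of L"
    using L excess_le_iff[OF assms(1), of _ 0] ab(1)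
    by (intro face_of_Int_supporting_hyperplane_le \<open>convex L\<close>) auto
  have "G \<subseteq> L \<inter> {y. a \<bullet> y = b}"
    by (rule subset_of_face_of[OF face GL(2)]) (use x xL ab(3) in blast)
  with ab show ?thesis by blast
qed

theorem theorem5:
  fixes L :: "(real^'n) set" and M M0 :: real and Q :: "((real^'n) \<times> real) set"
  assumes "full_dimensional L" and "rational_polytope L" and "lattice_free L"
    and "two_hyperplane_property L"
    and "M0 < M"
    and "polyhedron Q" and "Q \<subseteq> R_region L M M0"
  shows "\<exists>q::nat. height (split_closure_rank q Q) \<le> ereal M0"
proof (cases "\<exists>p\<in>Q. M0 < snd p")
  case False
  then have "height (split_closure_rank 0 Q) \<le> ereal M0"
    unfolding height_le_iff by (auto simp: split_closure_rank_def not_less)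
  then show ?thesis ..
next
  case ex: True
  obtain V0 where V0: "finite V0" "\<And>v. v \<in> V0 \<Longrightarrow> rat_point v" "L = convex hull V0"
    using assms(2) unfolding rational_polytope_def by blast
  have L: "compact L" "convex L" "closed L"
    using V0 by (auto simp: finite_imp_compact_convex_hull compact_imp_closed)
  have Lne: "L \<noteq> {}" using assms(1) interior_subset[of L] by (auto simp: full_dimensional_def)
  obtain R where R: "\<And>y. y \<in> L \<Longrightarrow> norm y \<le> R"
    using compact_imp_bounded[OF L(1)] unfolding bounded_iff by blast
  \<comment> \<open>Full dimension rules out a single point, so the quotient in
    \<open>R_region\<close> is a genuine one.\<close>
  have "0 < diameter L"
  proof (rule ccontr)
    assume "\<not> 0 < diameter L"
    then have "dist x y \<le> 0" if "x \<in> L" "y \<in> L" for x y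
      using diameter_bounded_bound[OF compact_imp_bounded[OF L(1)] that] by linarith
    moreover obtain y where "y \<in> L" using Lne by blast
    ultimately have "L \<subseteq> {y}" by auto
    then have "interior L \<subseteq> {}" using interior_mono[of L "{y}"] by simp
    then show False using assms(1) by (simp add: full_dimensional_def)
  qed
  define \<mu> where "\<mu> = (M - M0) / diameter L"
  have \<mu>: "0 < \<mu>" using \<open>0 < diameter L\<close> assms(5) by (simp add: \<mu>_def)
  have Qint: "z \<le> M" if "(x, z) \<in> Q" "x \<in> interior L" for x z
    using assms(7) that by (auto simp: R_region_def)
  have Qext: "z \<le> M0 - \<mu> * infdist x L" if "(x, z) \<in> Q" "x \<notin> interior L" for x z
    using assms(7) that by (auto simp: R_region_def \<mu>_def mult.commute)
  have ext_le: "M0 - \<mu> * infdist x L \<le> M0" for x using \<mu> infdist_nonneg[of x L] by simp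
  have QM: "z \<le> M" if "(x, z) \<in> Q" for x z
    using Qint[OF that] Qext[OF that] ext_le[of x] assms(5) by (cases "x \<in> interior L") auto
  have Qtop: "x \<in> interior L" if "(x, z) \<in> Q" "M0 < z" for x z
    using Qext[OF that(1)] ext_le[of x] that(2) by linarith
  have int0: "infdist x L = 0" if "x \<in> interior L" for x
    using that interior_subset[of L] by (auto simp: infdist_zero)
  have QL: "x \<in> L" if "(x, z) \<in> Q" "M0 \<le> z" for x z
  proof (cases "x \<in> interior L")
    case True then show ?thesis using interior_subset by blast
  next
    case False
    then have "\<mu> * infdist x L \<le> 0" using Qext[OF that(1)] that(2) by simp
    then have "infdist x L = 0" using \<mu> infdist_nonneg[of x L] by (simp add: mult_le_0_iff)
    then show ?thesis using in_closed_iff_infdist_zero[OF L(3) Lne] by simp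
  qed
  have Qdist: "infdist x L \<le> \<bar>M0 - z\<bar> / \<mu>" if "(x, z) \<in> Q" for x z
  proof (cases "x \<in> interior L")
    case True then show ?thesis using int0 \<mu> by simp
  next
    case False then show ?thesis using Qext[OF that] \<mu> by (simp add: field_simps)
  qed
  have compact_Q: "compact {p \<in> Q. s \<le> snd p}" for s
    unfolding compact_eq_bounded_closed
  proof
    have "{p \<in> Q. s \<le> snd p} = Q \<inter> {p. s \<le> snd p}" by auto
    moreover have "closed {p::(real^'n) \<times> real. s \<le> snd p}"
      by (intro closed_Collect_le continuous_intros)
    ultimately show "closed {p \<in> Q. s \<le> snd p}" using polyhedron_imp_closed[OF assms(6)] by auto
    define T where "T = \<bar>M0\<bar> + \<bar>s\<bar> + \<bar>M\<bar>"
    have "{p \<in> Q. s \<le> snd p} \<subseteq> cball 0 (R + T / \<mu>) \<times> cball 0 T"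
    proof (clarsimp, intro conjI)
      fix x z assume p: "(x, z) \<in> Q" and s: "s \<le> z"
      have z: "\<bar>z\<bar> \<le> T" "\<bar>M0 - z\<bar> \<le> T" using QM[OF p] s assms(5) by (auto simp: T_def)
      then show "\<bar>z\<bar> \<le> T" by simp
      obtain y where y: "y \<in> L" "infdist x L = dist x y" using infdist_attains_inf[OF L(3) Lne] by blast
      have "norm x \<le> norm y + dist x y" using norm_triangle_sub[of x y] by (simp add: dist_norm)
      also have "\<dots> \<le> R + \<bar>M0 - z\<bar> / \<mu>" using R[OF y(1)] Qdist[OF p] y(2) by simp
      also have "\<dots> \<le> R + T / \<mu>" using z(2) \<mu> by (simp add: divide_right_mono)
      finally show "norm x \<le> R + T / \<mu>" .
    qed
    then show "bounded {p \<in> Q. s \<le> snd p}"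
      by (rule bounded_subset[rotated]) (intro bounded_Times bounded_cball)
  qed
  \<comment> \<open>Two families of inequalities are needed: \<open>WL\<close> describes
    \<open>L\<close>, while \<open>W\<close> below describes the hull of its integer points.\<close>
  obtain WL where WL: "finite WL" "\<And>a b. (a, b) \<in> WL \<Longrightarrow> int_point a \<and> b \<in> \<int>"
    "\<And>a b. (\<forall>v\<in>V0. a \<bullet> v \<le> b) \<longleftrightarrow> (a, b) \<in> convex_cone hull WL"
    using rational_polytope_valid_inequalities[OF V0(1,2)] by blast
  have memL: "x \<in> L \<longleftrightarrow> excess WL x \<le> 0" for x
    using valid_inequalities_mem_hull[OF V0(1) WL(1,3)] V0(3) by simp
  have WLle: "a \<bullet> x \<le> b" if "(a, b) \<in> WL" "x \<in> L" for a b x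
    using that memL[of x] excess_le_iff[OF WL(1), of x 0] by auto
  have WLless: "a \<bullet> x < b" if "(a, b) \<in> WL" "a \<noteq> 0" "x \<in> interior L" for a b x
  proof -
    have "interior L \<subseteq> interior {y. a \<bullet> y \<le> b}" using WLle[OF that(1)] by (intro interior_mono) auto
    then show ?thesis using that by (auto simp: interior_halfspace_le)
  qed
  define V where "V = {x \<in> L. int_point x}"
  have finV: "finite V" unfolding V_def by (rule finite_int_points_bounded[OF compact_imp_bounded[OF L(1)]])
  have "\<And>v. v \<in> V \<Longrightarrow> rat_point v" using Ints_subset_Rats by (auto simp: V_def int_point_def rat_point_def)
  then obtain W where W: "finite W" "\<And>a b. (a, b) \<in> W \<Longrightarrow> int_point a \<and> b \<in> \<int>"
    "\<And>a b. (\<forall>v\<in>V. a \<bullet> v \<le> b) \<longleftrightarrow> (a, b) \<in> convex_cone hull W"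
    using rational_polytope_valid_inequalities[OF finV] by blast
  define K where "K k = ((\<lambda>S. closure (split_closure S)) ^^ k) Q" for k
  have K0: "K 0 = Q" by (simp add: K_def)
  interpret split_chain K
    unfolding K_def using compact_Q assms(6)
    by (intro split_chain_closed_closures polyhedron_imp_closed polyhedron_imp_convex)
  have notint: "v \<notin> interior L" if "int_point v" for v using assms(3) that by (auto simp: lattice_free_def)
  interpret lattice_free_chain K V W M0
  proof
    fix v z assume v: "int_point v" "(v, z) \<in> K 0"
    show "z \<le> M0" using Qext[of v z] notint[OF v(1)] v ext_le[of v] by (simp add: K0)
  next
    fix v assume v: "int_point v" "(v, M0) \<in> K 0"
    then show "v \<in> V" using QL[of v M0] by (simp add: K0 V_def)
  next
    obtain A B where AB: "0 < A" "0 < B" "\<And>x. excess W x \<le> A + B * infdist x L"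
      using excess_linear_growth[OF W(1) R L(3) Lne] by blast
    have "excess W x \<le> A + (B / \<mu>) * (M0 - z)" if "(x, z) \<in> K 0" "z \<le> M0" for x z
    proof -
      have "B * infdist x L \<le> B * (\<bar>M0 - z\<bar> / \<mu>)"
        using Qdist[of x z] that(1) AB(2) by (intro mult_left_mono) (auto simp: K0)
      then show ?thesis using AB(3)[of x] that(2) by simp
    qed
    then show "\<exists>A>0. \<exists>B>0. \<forall>x z. (x, z) \<in> K 0 \<longrightarrow> z \<le> M0 \<longrightarrow> excess W x \<le> A + B * (M0 - z)"
      using AB \<mu> by (intro exI[of _ A] conjI exI[of _ "B / \<mu>"]) auto
  qed (use finV W in auto)
  have "\<exists>k. \<forall>x z. (x, z) \<in> K k \<longrightarrow> z \<le> M0"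
  proof (cases "V = {}")
    case True then show ?thesis by (rule no_int_points)
  next
    case False
    \<comment> \<open>Points of \<open>Q\<close> at height at least \<open>M0\<close> lie over
      \<open>L\<close>, and those above \<open>M0\<close> over its interior, as the slope bound
      requires.\<close>
    have facet: "face_bound a b" if ab: "(a, b) \<in> WL" "a \<noteq> 0" for a b
    proof -
      have "\<exists>\<kappa>>0. \<forall>x z. (x, z) \<in> Q \<longrightarrow> z \<le> M0 + \<kappa> * (b - a \<bullet> x)"
        using WLle[OF ab(1) QL] WLless[OF ab Qtop] ex compact_imp_bounded[OF compact_Q]
        by (intro polyhedron_slope_bound assms(6)) auto
      then obtain \<kappa> where "0 < \<kappa>" "\<And>x z. (x, z) \<in> K 0 \<Longrightarrow> z \<le> M0 + \<kappa> * (b - a \<bullet> x)"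
        by (auto simp: K0)
      then show ?thesis using WL(2)[OF ab(1)] ab False WLle[OF ab(1)]
        by (intro facet_bound) (auto simp: V_def)
    qed
    have hullL: "integer_hull L \<subseteq> L"
      unfolding integer_hull_def using L(2) by (intro hull_minimal) auto
    \<comment> \<open>The pair \<open>(0, 0)\<close> exposes the integer hull as a face of
      itself.\<close>
    have "face_bound 0 0"
    proof (rule face_bound_induct)
      fix g \<gamma> assume g: "\<forall>v\<in>V. g \<bullet> v \<le> \<gamma>" and ne: "{v \<in> V. g \<bullet> v = \<gamma>} \<noteq> {}"
      define F where "F = integer_hull L \<inter> {x. g \<bullet> x = \<gamma>}"
      have "integer_hull L \<subseteq> {x. g \<bullet> x \<le> \<gamma>}"
        unfolding integer_hull_def using g
        by (intro hull_minimal convex_halfspace_le) (auto simp: V_def)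
      then have face: "F face_of integer_hull L"
        unfolding F_def by (intro face_of_Int_supporting_hyperplane_le) (auto simp: integer_hull_def)
      have VF: "{x \<in> F. int_point x} = {v \<in> V. g \<bullet> v = \<gamma>}"
        using hullL by (auto simp: F_def V_def integer_hull_def intro: hull_inc)
      have on_facet: "\<exists>a b. face_bound a b \<and> (\<forall>v\<in>V. g \<bullet> v = \<gamma> \<longrightarrow> b \<le> a \<bullet> v)"
        if "(a, b) \<in> WL" "a \<noteq> 0" "\<forall>v\<in>V. g \<bullet> v = \<gamma> \<longrightarrow> a \<bullet> v = b" for a b
        using facet[OF that(1,2)] that(3) by (intro exI[of _ a] exI[of _ b]) auto
      show "(\<exists>a b. face_bound a b \<and> (\<forall>v\<in>V. g \<bullet> v = \<gamma> \<longrightarrow> b \<le> a \<bullet> v)) \<or>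
        (\<exists>\<pi> \<pi>0 S1 S2. is_split \<pi> \<pi>0 \<and> S1 \<noteq> {} \<and> S2 \<noteq> {} \<and> S1 \<union> S2 = {v \<in> V. g \<bullet> v = \<gamma>} \<and>
          (\<forall>x\<in>S1. \<pi> \<bullet> x = \<pi>0) \<and> (\<forall>x\<in>S2. \<pi> \<bullet> x = \<pi>0 + 1))"
      proof (cases "\<exists>G. G facet_of L \<and> F \<subseteq> G")
        case True
        then obtain G where G: "G facet_of L" "F \<subseteq> G" by blast
        obtain a b where "(a, b) \<in> WL" "a \<noteq> 0" "\<forall>x\<in>G. a \<bullet> x = b"
          using facet_subset_hyperplane[OF WL(1) memL L(2) G(1)] by blast
        moreover have "{v \<in> V. g \<bullet> v = \<gamma>} \<subseteq> G" using VF G(2) by blast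
        ultimately show ?thesis using on_facet[of a b] by blast
      next
        case False
        then have "two_partitionable {v \<in> V. g \<bullet> v = \<gamma>}"
          using assms(4) face unfolding two_hyperplane_property_def VF[symmetric] by blast
        then show ?thesis
          unfolding two_partitionable_def
        proof (elim disjE)
          \<comment> \<open>A single integer point is on the boundary of \<open>L\<close> by
            lattice-freeness, hence on one of the hyperplanes of \<open>WL\<close>, and inherits the
            bound from there.\<close>
          assume "\<exists>v. {v \<in> V. g \<bullet> v = \<gamma>} \<subseteq> {v}"
          then obtain v where v: "{v \<in> V. g \<bullet> v = \<gamma>} \<subseteq> {v}" by blast
          then have "v \<in> V" using ne by blast
          then obtain a b where "(a, b) \<in> WL" "a \<noteq> 0" "a \<bullet> v = b"
            using polytope_boundary_hyperplane[OF WL(1) memL] notint[of v] unfolding V_def by blast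
          then show ?thesis using on_facet[of a b] v by blast
        qed blast
      qed
    qed (use False in auto)
    then show ?thesis by (rule face_bound_whole)
  qed
  then obtain k where "\<And>x z. (x, z) \<in> K k \<Longrightarrow> z \<le> M0" by blast
  then have "height (split_closure_rank k Q) \<le> ereal M0"
    using split_chain_rank[of k Q] unfolding height_le_iff K_def by blast
  then show ?thesis ..
qed

end
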